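(* Suppose $Y_1,Y_2,\ldots,Y_n\in(0,1)$ are i.i.d. drawn from a discrete distribution with $r$ atoms, $r\in O(1)$, each with probability at least $\frac{1}{\log n}$. Let $f=f(Y_1,\ldots,Y_n)$ be the minimum number of capacity-$1$ bins into which the items $Y_1,\ldots,Y_n$ can be packed. Let $EY_1=\mu\le\frac{1}{r^2\log n}$ and $\mathrm{Var}\,Y_1=\sigma^2$. Then for any $t\in(0,n(\mu^3+\sigma^2))$, $$\Pr\left(|f-Ef|\ge t+r\right)\le c_1e^{-ct^2/(n(\mu^3+\sigma^2))}.$$ Further, there is a distribution for the $Y_i$ (i.i.d. with values in $(0,1)$, with mean $\mu$ and variance $\sigma^2$) for which $\mathrm{Var}(f)\in\Omega\left(n(\mu^3+\sigma^2)\right)$.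
   Context: A set of items can be placed in one capacity-$1$ bin iff the sum of their sizes is at most $1$. The constants $c,c_1>0$ are independent of $n$, $t$, $\mu$, $\sigma$ and the distribution, given the bound on $r$ ($r\in O(1)$ means $r$ is bounded by a fixed constant as $n$ varies). $\log$ is the natural logarithm. $\Omega(\cdot)$ is as $n\to\infty$: $\mathrm{Var}(f)\ge c_0\,n(\mu^3+\sigma^2)$ for some constant $c_0>0$ and all large $n$. *)

theory Defs
  imports "HOL-Probability.Probability" "HOL-Library.Landau_Symbols"
begin

definition packable :: "nat \<Rightarrow> (nat \<Rightarrow> real) \<Rightarrow> nat \<Rightarrow> bool" where
  "packable n y m \<longleftrightarrow>
     (\<exists>bin :: nat \<Rightarrow> nat. (\<forall>i<n. bin i < m) \<and> (\<forall>j<m. (\<Sum>i | i < n \<and> bin i = j. y i) \<le> 1))"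

text \<open>The least element below exists whenever every item has size at most 1: use one bin per item.\<close>

definition min_bins :: "nat \<Rightarrow> (nat \<Rightarrow> real) \<Rightarrow> nat" where
  "min_bins n y = (LEAST m. packable n y m)"

text \<open>
  The joint law of n i.i.d. items with common law p. Coordinates outside the index set
  are constantly 0 and are never used.
\<close>

definition iid_items :: "nat \<Rightarrow> real pmf \<Rightarrow> (nat \<Rightarrow> real) pmf" where
  "iid_items n p = Pi_pmf {..<n} 0 (\<lambda>_. p)"

definition item_mean :: "real pmf \<Rightarrow> real" where
  "item_mean p = measure_pmf.expectation p (\<lambda>x. x)"

definition item_var :: "real pmf \<Rightarrow> real" where
  "item_var p = measure_pmf.variance p (\<lambda>x. x)"

definition bins_mean :: "nat \<Rightarrow> real pmf \<Rightarrow> real" where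
  "bins_mean n p = measure_pmf.expectation (iid_items n p) (\<lambda>y. real (min_bins n y))"

definition bins_var :: "nat \<Rightarrow> real pmf \<Rightarrow> real" where
  "bins_var n p = measure_pmf.variance (iid_items n p) (\<lambda>y. real (min_bins n y))"

text \<open>
  Meaningful for n at least 2 only, since division by \<^term>\<open>ln (real n)\<close> occurs.
  Finiteness is explicit because \<^const>\<open>card\<close> is 0 on infinite sets.
\<close>

definition admissible_law :: "nat \<Rightarrow> nat \<Rightarrow> real pmf \<Rightarrow> bool" where
  "admissible_law n r p \<longleftrightarrow>
     set_pmf p \<subseteq> {0<..<1} \<and>
     finite (set_pmf p) \<and> card (set_pmf p) = r \<and>
     (\<forall>a\<in>set_pmf p. pmf p a \<ge> 1 / ln (real n)) \<and>
     item_mean p \<le> 1 / ((real r)\<^sup>2 * ln (real n))"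

end

theory Submission
  imports Defs "HOL-Real_Asymp.Real_Asymp"
begin

text \<open>
  Write \<open>f\<close> for the minimum number of bins, \<open>S\<close> for the total size, \<open>x\<^sub>a\<close> for the number of items
  of size \<open>a\<close> and \<open>p\<^sub>a\<close> for the probability of \<open>a\<close>. If all \<open>x\<^sub>a\<close> are within a factor 2 of \<open>n p\<^sub>a\<close>, then
  passing to other such items changes \<open>f\<close> by the change of \<open>S\<close> up to an error of
  \<open>O(E Y\<^sup>2 / p\<^sub>a)\<close> per added or removed item of size \<open>a\<close>, and \<open>O(r)\<close>: new items are packed one size per bin,
  where an item of size \<open>a\<close> occupies at most \<open>a + 2 a\<^sup>2\<close> bins, and items are removed by opening a few
  bins that are rich in size \<open>a\<close> but poor in squared sizes and repacking the rest of their contents.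
  Since \<open>1 / p\<^sub>a \<le> ln n\<close> and \<open>\<mu> ln n \<le> 1\<close>, every term of this bound is a sum of \<open>n\<close> i.i.d. bounded centred
  variables of variance \<open>O(\<mu>\<^sup>3 + \<sigma>\<^sup>2)\<close>, to which a Bernstein-type inequality applies; the centre \<open>E f\<close> is reached by
  comparing with an independent copy. Additive errors of order \<open>sqrt (n (\<mu>\<^sup>3 + \<sigma>\<^sup>2))\<close> are absorbed by the constants.

  For the lower bound, sizes \<open>1/(2k)\<close> and \<open>1/k\<close> pack almost perfectly, so \<open>f = S + O(1)\<close> and
  \<open>Var f\<close> is of order \<open>n \<sigma>\<^sup>2\<close>, where \<open>\<sigma>\<^sup>2\<close> has order at least \<open>\<mu>\<^sup>3\<close>. The choice \<open>k \<approx> 3 ln n\<close> meets the constraint on the mean.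
\<close>

subsection \<open>Repacking\<close>

definition item_count :: "nat \<Rightarrow> (nat \<Rightarrow> real) \<Rightarrow> real \<Rightarrow> nat" where
  "item_count n y a = card {i. i < n \<and> y i = a}"

lemma sum_items_by_size:
  fixes g :: "real \<Rightarrow> real"
  assumes "finite A" "\<forall>i<n. y i \<in> A"
  shows "(\<Sum>i<n. g (y i)) = (\<Sum>a\<in>A. item_count n y a * g a)"
proof -
  have "(\<Sum>i<n. g (y i)) = (\<Sum>a\<in>A. \<Sum>i | i \<in> {..<n} \<and> y i = a. g (y i))"
    by (rule sum.group[symmetric]) (use assms in auto)
  also have "\<dots> = (\<Sum>a\<in>A. item_count n y a * g a)"
    by (simp add: item_count_def)
  finally show ?thesis .
qed

section \<open>Choosing a cheap subfamily of bins\<close>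

text \<open>Greedy removal: elements with an above-average ratio of \<open>w\<close> to
  \<open>u\<close> are discarded while the rest still has \<open>u\<close>-weight at least
  \<open>d\<close>. The average ratio never increases, and the last element that cannot be discarded
  overshoots by at most 1 in \<open>w\<close>. The absolute value keeps the bound nonnegative for
  \<open>d \<le> 0\<close>, where the empty set serves.\<close>

lemma exists_subset_small_ratio:
  fixes u w :: "'b \<Rightarrow> real"
  assumes "finite B" "\<And>b. b \<in> B \<Longrightarrow> 0 \<le> u b" "\<And>b. b \<in> B \<Longrightarrow> 0 \<le> w b" "\<And>b. b \<in> B \<Longrightarrow> w b \<le> 1"
    and "d \<le> sum u B"
  shows "\<exists>S\<subseteq>B. d \<le> sum u S \<and> sum w S \<le> \<bar>d\<bar> * sum w B / sum u B + 1"
  using assms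
proof (induction "card B" arbitrary: B rule: less_induct)
  case less
  have W0: "0 \<le> sum w B" and U0: "0 \<le> sum u B"
    using less.prems by (auto intro!: sum_nonneg)
  show ?case
  proof (cases "d \<le> 0")
    case True
    moreover have "0 \<le> \<bar>d\<bar> * sum w B / sum u B"
      using W0 U0 by (intro divide_nonneg_nonneg mult_nonneg_nonneg) auto
    ultimately show ?thesis
      by (intro exI[of _ "{}"]) auto
  next
    case False
    then have U: "0 < sum u B" and ne: "B \<noteq> {}"
      using less.prems(5) by auto
    \<comment> \<open>If every element had a ratio below the average, summing over \<open>B\<close>
      would give \<open>sum w B * sum u B\<close> strictly below itself.\<close>
    obtain b where b: "b \<in> B" "sum w B * u b \<le> w b * sum u B"
    proof (rule ccontr)
      assume "\<not> thesis"
      then have "(\<Sum>b\<in>B. w b * sum u B) < (\<Sum>b\<in>B. sum w B * u b)"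
        using that by (intro sum_strict_mono ne less.prems) force
      then show False
        by (simp flip: sum_distrib_left sum_distrib_right)
    qed
    have su: "sum u B = u b + sum u (B - {b})" and sw: "sum w B = w b + sum w (B - {b})"
      using b less.prems(1) by (auto simp: sum.remove)
    show ?thesis
    proof (cases "d \<le> sum u (B - {b})")
      case True
      have "card (B - {b}) < card B"
        using b less.prems(1) by (meson card_Diff1_less)
      then obtain S where S: "S \<subseteq> B - {b}" "d \<le> sum u S"
        "sum w S \<le> \<bar>d\<bar> * sum w (B - {b}) / sum u (B - {b}) + 1"
        using less.hyps[of "B - {b}"] less.prems True by auto
      have U': "0 < sum u (B - {b})"
        using True False by linarith
      have "sum w (B - {b}) * sum u B \<le> sum w B * sum u (B - {b})"
        using b(2) unfolding su sw by (simp add: algebra_simps)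
      then have "sum w (B - {b}) / sum u (B - {b}) \<le> sum w B / sum u B"
        using U U' by (simp add: divide_simps mult.commute)
      then have "\<bar>d\<bar> * (sum w (B - {b}) / sum u (B - {b})) \<le> \<bar>d\<bar> * (sum w B / sum u B)"
        by (intro mult_left_mono) auto
      then show ?thesis
        using S by (intro exI[of _ S]) auto
    next
      \<comment> \<open>Without \<open>b\<close> too little remains, so the excess
        \<open>sum u B - d\<close> is below \<open>u b\<close>. The excess times the average ratio
        is then at most \<open>w b\<close>, hence at most 1, and \<open>B\<close> itself
        qualifies.\<close>
      case F: False
      have "sum w B * (sum u B - d) \<le> sum w B * u b"
        using F su W0 by (intro mult_left_mono) auto
      also have "\<dots> \<le> w b * sum u B" by (rule b)
      also have "\<dots> \<le> 1 * sum u B"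
        using less.prems(4)[OF b(1)] U0 by (intro mult_right_mono) auto
      finally have "sum w B \<le> d * sum w B / sum u B + 1"
        using U by (simp add: field_simps)
      then show ?thesis
        using less.prems(5) False by (intro exI[of _ B]) auto
    qed
  qed
qed

section \<open>Packings as families of bin patterns\<close>

text \<open>The pattern \<open>b j a\<close> counts the items of size \<open>a\<close> in bin
  \<open>j\<close>. Items of equal size are interchangeable, so patterns carry all the information
  that repacking needs.\<close>

lemma packable_imp_patterns:
  fixes A :: "real set"
  assumes "packable n y m" "finite A" "\<forall>i<n. y i \<in> A"
  shows "\<exists>b :: nat \<Rightarrow> real \<Rightarrow> nat. (\<forall>j<m. (\<Sum>a\<in>A. a * b j a) \<le> 1) \<and>
           (\<forall>a\<in>A. item_count n y a = (\<Sum>j<m. b j a))"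
proof -
  obtain bin :: "nat \<Rightarrow> nat" where bin: "\<forall>i<n. bin i < m"
    "\<forall>j<m. (\<Sum>i | i < n \<and> bin i = j. y i) \<le> 1"
    using assms(1) by (auto simp: packable_def)
  define b where "b = (\<lambda>j a. card {i \<in> {i. i < n \<and> bin i = j}. y i = a})"
  have "(\<Sum>a\<in>A. a * b j a) = (\<Sum>i | i < n \<and> bin i = j. y i)" for j
  proof -
    have "(\<Sum>i | i < n \<and> bin i = j. y i) = (\<Sum>a\<in>A. \<Sum>i | i \<in> {i. i < n \<and> bin i = j} \<and> y i = a. y i)"
      by (rule sum.group[symmetric]) (use assms in auto)
    then show ?thesis by (simp add: b_def mult.commute)
  qed
  moreover have "item_count n y a = (\<Sum>j<m. b j a)" for a
  proof -
    have "item_count n y a = (\<Sum>i | i < n \<and> y i = a. 1)"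
      by (simp add: item_count_def)
    also have "\<dots> = (\<Sum>j<m. \<Sum>i | i \<in> {i. i < n \<and> y i = a} \<and> bin i = j. 1)"
      by (rule sum.group[symmetric]) (use bin in auto)
    also have "\<dots> = (\<Sum>j<m. b j a)"
      by (intro sum.cong) (auto simp: b_def intro!: arg_cong[where f = card])
    finally show ?thesis .
  qed
  ultimately show ?thesis
    using bin by (intro exI[of _ b]) auto
qed

text \<open>Patterns provide slots; the items of each size are injected into the slots of that size,
  and unfilled slots only make a bin lighter because sizes are positive. The index type of the bins
  is arbitrary so that kept and new bins can be combined as a disjoint sum.\<close>

lemma patterns_imp_packable:
  fixes b :: "'b \<Rightarrow> real \<Rightarrow> nat"
  assumes A: "finite A" "\<forall>a\<in>A. 0 < a" and J: "finite J" and y: "\<forall>i<n. y i \<in> A"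
    and cap: "\<forall>j\<in>J. (\<Sum>a\<in>A. a * b j a) \<le> 1"
    and cover: "\<forall>a\<in>A. item_count n y a \<le> (\<Sum>j\<in>J. b j a)"
  shows "packable n y (card J)"
proof -
  have "\<forall>a\<in>A. \<exists>h. h ` {i. i < n \<and> y i = a} \<subseteq> (SIGMA j:J. {..<b j a}) \<and>
      inj_on h {i. i < n \<and> y i = a}"
    using cover J by (intro ballI card_le_inj) (auto simp: item_count_def)
  then obtain h where "\<forall>a\<in>A. h a ` {i. i < n \<and> y i = a} \<subseteq> (SIGMA j:J. {..<b j a}) \<and>
      inj_on (h a) {i. i < n \<and> y i = a}"
    by (rule bchoice[THEN exE])
  then have h: "\<And>a. a \<in> A \<Longrightarrow> inj_on (h a) {i. i < n \<and> y i = a}"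
    "\<And>a. a \<in> A \<Longrightarrow> h a ` {i. i < n \<and> y i = a} \<subseteq> (SIGMA j:J. {..<b j a})"
    by auto
  obtain e where e: "bij_betw e J {..<card J}"
    using ex_bij_betw_finite_nat[OF J] by (auto simp: atLeast0LessThan)
  define bin where "bin = (\<lambda>i. e (fst (h (y i) i)))"
  have hJ: "fst (h (y i) i) \<in> J" "snd (h (y i) i) < b (fst (h (y i) i)) (y i)" if "i < n" for i
    using h(2)[of "y i"] y that by force+
  have "bin i < card J" if "i < n" for i
    using hJ[OF that] e by (auto simp: bin_def bij_betw_def)
  moreover have "(\<Sum>i | i < n \<and> bin i = k. y i) \<le> 1" if k: "k < card J" for k
  proof -
    obtain j where j: "j \<in> J" "e j = k"
      using e k by (metis bij_betw_def imageE lessThan_iff)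
    have eq: "fst (h (y i) i) = j" if "i < n" "bin i = k" for i
      using e j that hJ[of i] by (auto simp: bij_betw_def inj_on_def bin_def)
    have le: "card {i \<in> {i. i < n \<and> bin i = k}. y i = a} \<le> b j a" if a: "a \<in> A" for a
    proof -
      \<comment> \<open>Items sent to the same bin agree in the first component of their slot, so
        injectivity of \<open>h a\<close> passes to the second component.\<close>
      have "inj_on (\<lambda>i. snd (h a i)) {i \<in> {i. i < n \<and> bin i = k}. y i = a}"
      proof (rule inj_onI)
        fix i i' assume i: "i \<in> {i \<in> {i. i < n \<and> bin i = k}. y i = a}"
          "i' \<in> {i \<in> {i. i < n \<and> bin i = k}. y i = a}" "snd (h a i) = snd (h a i')"
        then have "fst (h a i) = fst (h a i')" using eq[of i] eq[of i'] by auto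
        then have "h a i = h a i'" using i(3) by (simp add: prod_eq_iff)
        then show "i = i'" using inj_onD[OF h(1)[OF a]] i by auto
      qed
      moreover have "(\<lambda>i. snd (h a i)) ` {i \<in> {i. i < n \<and> bin i = k}. y i = a} \<subseteq> {..<b j a}"
        using hJ eq by auto
      ultimately have "card {i \<in> {i. i < n \<and> bin i = k}. y i = a} \<le> card {..<b j a}"
        by (rule card_inj_on_le) simp
      then show ?thesis by simp
    qed
    have "(\<Sum>i | i < n \<and> bin i = k. y i) = (\<Sum>a\<in>A. \<Sum>i | i \<in> {i. i < n \<and> bin i = k} \<and> y i = a. y i)"
      by (rule sum.group[symmetric]) (use A y in auto)
    also have "\<dots> = (\<Sum>a\<in>A. a * card {i \<in> {i. i < n \<and> bin i = k}. y i = a})"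
      by (simp add: mult.commute)
    also have "\<dots> \<le> (\<Sum>a\<in>A. a * b j a)"
      using A le by (intro sum_mono mult_left_mono) (auto simp: less_imp_le)
    finally show ?thesis using cap j by auto
  qed
  ultimately show ?thesis
    unfolding packable_def by (intro exI[of _ bin]) auto
qed

lemma packable_trivial:
  assumes "\<forall>i<n. y i \<le> 1"
  shows "packable n y n"
proof -
  have "{i. i < n \<and> i = j} = {j}" if "j < n" for j using that by auto
  then show ?thesis
    unfolding packable_def using assms by (intro exI[of _ id]) auto
qed

lemma packable_min_bins: "\<forall>i<n. y i \<le> 1 \<Longrightarrow> packable n y (min_bins n y)"
  unfolding min_bins_def by (rule LeastI) (rule packable_trivial)

lemma min_bins_le: "packable n y m \<Longrightarrow> min_bins n y \<le> m"
  unfolding min_bins_def by (rule Least_le)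

lemma min_bins_le_items: "\<forall>i<n. y i \<le> 1 \<Longrightarrow> min_bins n y \<le> n"
  by (rule min_bins_le) (rule packable_trivial)

lemma sum_items_le_min_bins:
  assumes "\<forall>i<n. y i \<le> 1"
  shows "(\<Sum>i<n. y i) \<le> min_bins n y"
proof -
  obtain bin :: "nat \<Rightarrow> nat" where bin: "\<forall>i<n. bin i < min_bins n y"
    "\<forall>j<min_bins n y. (\<Sum>i | i < n \<and> bin i = j. y i) \<le> 1"
    using packable_min_bins[OF assms] by (auto simp: packable_def)
  have "(\<Sum>i<n. y i) = (\<Sum>j<min_bins n y. \<Sum>i | i \<in> {..<n} \<and> bin i = j. y i)"
    by (rule sum.group[symmetric]) (use bin in auto)
  also have "\<dots> \<le> (\<Sum>j<min_bins n y. 1)"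
    using bin by (intro sum_mono) auto
  finally show ?thesis by simp
qed

text \<open>Bins kept as they are, plus bins filled with items of one size each.\<close>

lemma min_bins_le_kept_plus_new:
  fixes b :: "nat \<Rightarrow> real \<Rightarrow> nat" and A :: "real set"
  assumes A: "finite A" "A \<subseteq> {0<..1}" and J: "finite J" and y: "\<forall>i<n. y i \<in> A"
    and cap: "\<forall>j\<in>J. (\<Sum>a\<in>A. a * b j a) \<le> 1"
  shows "min_bins n y \<le> card J +
    (\<Sum>a\<in>A. real (item_count n y a - (\<Sum>j\<in>J. b j a)) / real_of_int \<lfloor>1 / a\<rfloor> + 1)"
proof -
  \<comment> \<open>For each size \<open>a\<close>: \<open>k a\<close> items fit into one new bin,
    \<open>d a\<close> items are not covered by the kept bins (truncated at 0), and
    \<open>h a\<close> new bins take them.\<close>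
  define k where "k = (\<lambda>a. nat \<lfloor>1 / a :: real\<rfloor>)"
  define d where "d = (\<lambda>a. item_count n y a - (\<Sum>j\<in>J. b j a))"
  define h where "h = (\<lambda>a. nat \<lceil>real (d a) / real (k a)\<rceil>)"
  have k1: "1 \<le> k a" "real (k a) = real_of_int \<lfloor>1 / a\<rfloor>" "a * k a \<le> 1" if "a \<in> A" for a
  proof -
    have a: "0 < a" "a \<le> 1" using A that by auto
    then have fl: "1 \<le> \<lfloor>1 / a\<rfloor>" by (simp only: le_floor_iff) simp
    then show "1 \<le> k a" unfolding k_def by linarith
    show e: "real (k a) = real_of_int \<lfloor>1 / a\<rfloor>"
      unfolding k_def using fl by (intro of_nat_nat) linarith
    have "a * real_of_int \<lfloor>1 / a\<rfloor> \<le> a * (1 / a)"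
      using a by (intro mult_left_mono of_int_floor_le) auto
    then show "a * k a \<le> 1" unfolding e using a by simp
  qed
  have hk: "d a \<le> h a * k a" if "a \<in> A" for a
  proof -
    have "real (d a) / real (k a) \<le> real (h a)"
      unfolding h_def by (simp add: real_nat_ceiling_ge)
    then have "real (d a) \<le> real (h a * k a)"
      using k1(1)[OF that] by (simp add: field_simps)
    then show ?thesis by (rule of_nat_le_iff[THEN iffD1])
  qed
  define K where "K = J <+> (SIGMA a:A. {..<h a})"
  define c where "c = case_sum b (\<lambda>(a, _ :: nat) a'. if a' = a then k a else 0)"
  have fK: "finite K" using A J by (auto simp: K_def)
  have "packable n y (card K)"
  proof (rule patterns_imp_packable[where A = A and b = c])
    show "\<forall>j\<in>K. (\<Sum>a\<in>A. a * c j a) \<le> 1"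
    proof
      fix j assume j: "j \<in> K"
      show "(\<Sum>a\<in>A. a * c j a) \<le> 1"
      proof (cases j)
        case (Inl i)
        then show ?thesis using j cap by (auto simp: K_def c_def)
      next
        case (Inr q)
        then obtain a i where q: "q = (a, i)" "a \<in> A" using j by (auto simp: K_def)
        have "(\<Sum>a'\<in>A. a' * c j a') = (\<Sum>a'\<in>A. if a' = a then a * k a else 0)"
          using Inr q by (intro sum.cong) (auto simp: c_def)
        then show ?thesis using q A k1 by simp
      qed
    qed
    show "\<forall>a\<in>A. item_count n y a \<le> (\<Sum>j\<in>K. c j a)"
    proof
      fix a assume a: "a \<in> A"
      have "(\<Sum>j\<in>K. c j a) = (\<Sum>j\<in>J. b j a) + (\<Sum>q\<in>(SIGMA a:A. {..<h a}). c (Inr q) a)"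
        unfolding K_def using A J by (subst sum.Plus) (auto simp: c_def)
      also have "(\<Sum>q\<in>(SIGMA a:A. {..<h a}). c (Inr q) a) = (\<Sum>a'\<in>A. \<Sum>i<h a'. c (Inr (a', i)) a)"
        using A by (subst sum.Sigma) (auto simp: split_def)
      also have "\<dots> = (\<Sum>a'\<in>A. if a' = a then h a * k a else 0)"
        by (intro sum.cong) (auto simp: c_def)
      also have "\<dots> = h a * k a" using A a by simp
      finally show "item_count n y a \<le> (\<Sum>j\<in>K. c j a)"
        using hk[OF a] by (simp add: d_def)
    qed
  qed (use A y fK in auto)
  then have "real (min_bins n y) \<le> card K" using min_bins_le by simp
  also have "card K = card J + (\<Sum>a\<in>A. h a)"
    using A J by (simp add: K_def card_Plus card_SigmaI)
  also have "real (card J + (\<Sum>a\<in>A. h a)) = card J + (\<Sum>a\<in>A. real (h a))" by simp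
  also have "\<dots> \<le> card J + (\<Sum>a\<in>A. real (d a) / real_of_int \<lfloor>1 / a\<rfloor> + 1)"
  proof (intro add_left_mono sum_mono)
    fix a assume a: "a \<in> A"
    have "0 \<le> real (d a) / real (k a)" by simp
    then have "0 \<le> \<lceil>real (d a) / real (k a)\<rceil>" by linarith
    then have "real (h a) = of_int \<lceil>real (d a) / real (k a)\<rceil>"
      unfolding h_def by (rule of_nat_nat)
    then show "real (h a) \<le> real (d a) / real_of_int \<lfloor>1 / a\<rfloor> + 1"
      unfolding k1(2)[OF a, symmetric] by (simp only: of_int_ceiling_le_add_one)
  qed
  finally show ?thesis by (simp add: d_def)
qed

text \<open>This is the cost per item of bins holding only size \<open>a\<close>. With
  \<open>k\<close> the floor of \<open>1 / a\<close>, one has \<open>1 < a * k + a\<close> and also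
  \<open>1 \<le> 2 * (a * k)\<close>; multiplying the latter by \<open>a\<close> bounds the last
  summand of the former by \<open>2 * a\<^sup>2 * k\<close>.\<close>

lemma inverse_floor_inverse_le:
  fixes a :: real
  assumes "0 < a" "a \<le> 1"
  shows "1 / real_of_int \<lfloor>1 / a\<rfloor> \<le> a + 2 * a\<^sup>2"
proof -
  define k where "k = real_of_int \<lfloor>1 / a\<rfloor>"
  have "1 \<le> \<lfloor>1 / a\<rfloor>" using assms by (simp only: le_floor_iff) simp
  then have k: "1 \<le> k" by (simp add: k_def)
  have "1 / a < k + 1" unfolding k_def by linarith
  then have 1: "1 < a * k + a" using assms by (simp add: field_simps)
  have "a * 1 \<le> a * k" using assms k by (intro mult_left_mono) auto
  with 1 have "1 \<le> 2 * (a * k)" by linarith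
  then have "a * 1 \<le> a * (2 * (a * k))" using assms by (intro mult_left_mono) auto
  then have "1 \<le> (a + 2 * a\<^sup>2) * k" using 1 by (simp add: algebra_simps power2_eq_square)
  then show ?thesis using k unfolding k_def[symmetric] by (simp add: field_simps)
qed

text \<open>
  For every size \<open>a\<close> of which \<open>y'\<close> has fewer items than \<open>y\<close>, a family \<open>S a\<close> of bins of an optimal
  packing of \<open>y\<close> holds at least the surplus of size-\<open>a\<close> items and is cheap in terms of
  squared sizes. All these bins are opened and their contents, adjusted to \<open>y'\<close>, are packed anew;
  since the total size of the contents is at most the number of opened bins, the empty
  space in them costs nothing.
\<close>

lemma min_bins_change:
  fixes A :: "real set"
  assumes A: "finite A" "A \<subseteq> {0<..1}" and y: "\<forall>i<n. y i \<in> A" "\<forall>i<n. y' i \<in> A"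
  defines "x \<equiv> \<lambda>a. real (item_count n y a)" and "x' \<equiv> \<lambda>a. real (item_count n y' a)"
  shows "real (min_bins n y') \<le> real (min_bins n y) + ((\<Sum>i<n. y' i) - (\<Sum>i<n. y i)) +
     (\<Sum>a\<in>A. (2 * a\<^sup>2 + 2 * (\<Sum>i<n. (y i)\<^sup>2) / x a) * \<bar>x' a - x a\<bar>) + 3 * card A"
proof -
  define m where "m = min_bins n y"
  define Q where "Q = (\<Sum>i<n. (y i)\<^sup>2)"
  have "packable n y m"
    unfolding m_def using A y by (intro packable_min_bins) auto
  from packable_imp_patterns[OF this A(1) y(1)]
  obtain b where b: "\<forall>j<m. (\<Sum>a\<in>A. a * real (b j a)) \<le> 1"
    "\<forall>a\<in>A. item_count n y a = (\<Sum>j<m. b j a)"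
    by blast
  define w where "w = (\<lambda>j. \<Sum>a\<in>A. a\<^sup>2 * real (b j a))"
  have w0: "0 \<le> w j" for j
    by (auto simp: w_def intro!: sum_nonneg)
  have w1: "w j \<le> 1" if "j < m" for j
  proof -
    have "a\<^sup>2 \<le> a" if "a \<in> A" for a
      using A that by (auto simp: power2_eq_square mult_left_le)
    then have "w j \<le> (\<Sum>a\<in>A. a * real (b j a))"
      unfolding w_def by (intro sum_mono mult_right_mono) auto
    then show ?thesis using b that by force
  qed
  have Q: "sum w {..<m} = Q"
  proof -
    have "sum w {..<m} = (\<Sum>a\<in>A. a\<^sup>2 * real (\<Sum>j<m. b j a))"
      unfolding w_def by (subst sum.swap) (simp add: sum_distrib_left)
    also have "\<dots> = Q"
      using b(2) unfolding Q_def by (subst sum_items_by_size[OF A(1) y(1)]) (simp add: mult.commute)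
    finally show ?thesis .
  qed
  \<comment> \<open>The subset lemma is applied to the bins with weight \<open>u\<close> the number
    of size-\<open>a\<close> items and cost \<open>w\<close> the squared sizes. When
    \<open>y'\<close> has at least as many such items as \<open>y\<close>, the requirement is
    vacuous.\<close>
  have "\<forall>a\<in>A. \<exists>S. S \<subseteq> {..<m} \<and> x a - x' a \<le> (\<Sum>j\<in>S. real (b j a)) \<and>
      sum w S \<le> \<bar>x a - x' a\<bar> * Q / x a + 1"
  proof
    fix a assume a: "a \<in> A"
    have "(\<Sum>j<m. real (b j a)) = x a"
      using b(2) a by (simp add: x_def flip: of_nat_sum)
    moreover have "x a - x' a \<le> x a" by (simp add: x'_def)
    ultimately show "\<exists>S. S \<subseteq> {..<m} \<and> x a - x' a \<le> (\<Sum>j\<in>S. real (b j a)) \<and>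
        sum w S \<le> \<bar>x a - x' a\<bar> * Q / x a + 1"
      using exists_subset_small_ratio[of "{..<m}" "\<lambda>j. real (b j a)" w "x a - x' a"] w0 w1 Q
      by auto
  qed
  then obtain S where "\<forall>a\<in>A. S a \<subseteq> {..<m} \<and> x a - x' a \<le> (\<Sum>j\<in>S a. real (b j a)) \<and>
      sum w (S a) \<le> \<bar>x a - x' a\<bar> * Q / x a + 1"
    by (rule bchoice[THEN exE])
  then have S: "\<And>a. a \<in> A \<Longrightarrow> S a \<subseteq> {..<m}"
    "\<And>a. a \<in> A \<Longrightarrow> x a - x' a \<le> (\<Sum>j\<in>S a. real (b j a))"
    "\<And>a. a \<in> A \<Longrightarrow> sum w (S a) \<le> \<bar>x a - x' a\<bar> * Q / x a + 1"
    by auto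
  define B where "B = (\<Union>a\<in>A. S a)"
  define c where "c = (\<lambda>a. \<Sum>j\<in>B. real (b j a))"
  have B: "B \<subseteq> {..<m}" "finite B"
  proof -
    show "B \<subseteq> {..<m}" using S(1) by (auto simp: B_def)
    then show "finite B" by (rule finite_subset) simp
  qed
  have c0: "0 \<le> c a" for a
    by (auto simp: c_def intro: sum_nonneg)
  have wB: "(\<Sum>a\<in>A. a\<^sup>2 * c a) \<le> (\<Sum>a\<in>A. \<bar>x' a - x a\<bar> * Q / x a) + card A"
  proof -
    have "(\<Sum>a\<in>A. a\<^sup>2 * c a) = sum w B"
      unfolding w_def c_def sum_distrib_left by (rule sum.swap)
    also have "\<dots> \<le> (\<Sum>a\<in>A. sum w (S a))"
    proof -
      have fS: "\<forall>a\<in>A. finite (S a)"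
        using S(1) by (meson finite_lessThan finite_subset)
      \<comment> \<open>The families may overlap; \<open>B\<close> is the image of their disjoint
        union, and counting shared bins repeatedly only increases the sum since \<open>w\<close> is
        nonnegative.\<close>
      have "B = snd ` Sigma A S" by (force simp: B_def)
      then have "sum w B \<le> (\<Sum>q\<in>Sigma A S. w (snd q))"
        using A fS w0 sum_image_le[of "Sigma A S" w snd] by (simp add: comp_def)
      also have "\<dots> = (\<Sum>a\<in>A. sum w (S a))"
        using A fS by (subst sum.Sigma) (auto simp: split_def)
      finally show ?thesis .
    qed
    also have "\<dots> \<le> (\<Sum>a\<in>A. \<bar>x' a - x a\<bar> * Q / x a + 1)"
      using S(3) by (intro sum_mono) (simp add: abs_minus_commute)
    finally show ?thesis by (simp add: sum.distrib)
  qed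
  have cB: "(\<Sum>a\<in>A. a * c a) \<le> card B"
  proof -
    have "(\<Sum>a\<in>A. a * c a) = (\<Sum>j\<in>B. \<Sum>a\<in>A. a * real (b j a))"
      unfolding c_def sum_distrib_left by (rule sum.swap)
    also have "\<dots> \<le> (\<Sum>j\<in>B. 1)" using b(1) B by (intro sum_mono) auto
    finally show ?thesis by simp
  qed
  define J where "J = {..<m} - B"
  have cJ: "real (card J) = real m - card B"
    using B card_mono[of "{..<m}" B] by (simp add: J_def card_Diff_subset)
  have d: "real (item_count n y' a - (\<Sum>j\<in>J. b j a)) = x' a - x a + c a" if a: "a \<in> A" for a
  proof -
    have "(\<Sum>j<m. b j a) = (\<Sum>j\<in>J. b j a) + (\<Sum>j\<in>B. b j a)"
      unfolding J_def using B by (metis add.commute finite_lessThan sum.subset_diff)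
    then have 1: "x a = real (\<Sum>j\<in>J. b j a) + c a"
      using b(2) a by (simp add: x_def c_def)
    have "(\<Sum>j\<in>S a. real (b j a)) \<le> c a"
      unfolding c_def using B a by (intro sum_mono2) (auto simp: B_def)
    \<comment> \<open>The kept bins hold no more size-\<open>a\<close> items than \<open>y'\<close>
      has, so the subtraction of naturals in the bound for kept and new bins is not
      truncated.\<close>
    with S(2)[OF a] 1 have "real (\<Sum>j\<in>J. b j a) \<le> x' a" by linarith
    then have "(\<Sum>j\<in>J. b j a) \<le> item_count n y' a" unfolding x'_def by (rule of_nat_le_iff[THEN iffD1])
    then show ?thesis using 1 by (simp add: x'_def of_nat_diff)
  qed
  have "real (min_bins n y') \<le> card J +
      (\<Sum>a\<in>A. real (item_count n y' a - (\<Sum>j\<in>J. b j a)) / real_of_int \<lfloor>1 / a\<rfloor> + 1)"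
    using A y b(1) by (intro min_bins_le_kept_plus_new) (auto simp: J_def)
  also have "\<dots> \<le> card J + (\<Sum>a\<in>A. (a * x' a - a * x a + a * c a) +
      2 * a\<^sup>2 * \<bar>x' a - x a\<bar> + 2 * (a\<^sup>2 * c a) + 1)"
  proof (intro add_left_mono sum_mono add_right_mono)
    fix a assume a: "a \<in> A"
    have d0: "0 \<le> x' a - x a + c a" using d[OF a] by (metis of_nat_0_le_iff)
    have "real (item_count n y' a - (\<Sum>j\<in>J. b j a)) / real_of_int \<lfloor>1 / a\<rfloor> =
        (x' a - x a + c a) * (1 / real_of_int \<lfloor>1 / a\<rfloor>)" using d[OF a] by simp
    also have "\<dots> \<le> (x' a - x a + c a) * (a + 2 * a\<^sup>2)"
      using a A d0 by (intro mult_left_mono inverse_floor_inverse_le) auto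
    also have "\<dots> = (a * x' a - a * x a + a * c a) + 2 * a\<^sup>2 * (x' a - x a) + 2 * (a\<^sup>2 * c a)"
      by (simp add: algebra_simps)
    also have "\<dots> \<le> (a * x' a - a * x a + a * c a) + 2 * a\<^sup>2 * \<bar>x' a - x a\<bar> + 2 * (a\<^sup>2 * c a)"
      by (intro add_mono order_refl mult_left_mono[where c = "2 * a\<^sup>2"]) auto
    finally show "real (item_count n y' a - (\<Sum>j\<in>J. b j a)) / real_of_int \<lfloor>1 / a\<rfloor> \<le> \<dots>" .
  qed
  also have "\<dots> = card J + (\<Sum>a\<in>A. a * x' a) - (\<Sum>a\<in>A. a * x a) + (\<Sum>a\<in>A. a * c a)
      + (\<Sum>a\<in>A. 2 * a\<^sup>2 * \<bar>x' a - x a\<bar>) + 2 * (\<Sum>a\<in>A. a\<^sup>2 * c a) + card A"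
    by (simp add: sum.distrib sum_subtractf sum_distrib_left)
  \<comment> \<open>The opened bins cancel: they reduce \<open>card J\<close> by
    \<open>card B\<close>, while the total size of their contents is at most \<open>card B\<close>.
    Twice the bound \<open>wB\<close> contributes \<open>2 * card A\<close>, and rounding up each
    size contributes another \<open>card A\<close>.\<close>
  also have "\<dots> \<le> real m + (\<Sum>a\<in>A. a * x' a) - (\<Sum>a\<in>A. a * x a)
      + (\<Sum>a\<in>A. 2 * a\<^sup>2 * \<bar>x' a - x a\<bar>) + 2 * (\<Sum>a\<in>A. \<bar>x' a - x a\<bar> * Q / x a) + 3 * card A"
    using cJ cB wB by linarith
  also have "(\<Sum>a\<in>A. 2 * a\<^sup>2 * \<bar>x' a - x a\<bar>) + 2 * (\<Sum>a\<in>A. \<bar>x' a - x a\<bar> * Q / x a) =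
      (\<Sum>a\<in>A. (2 * a\<^sup>2 + 2 * Q / x a) * \<bar>x' a - x a\<bar>)"
    by (simp add: sum.distrib[symmetric] sum_distrib_left algebra_simps)
  moreover have "(\<Sum>i<n. y i) = (\<Sum>a\<in>A. a * x a)" "(\<Sum>i<n. y' i) = (\<Sum>a\<in>A. a * x' a)"
    using sum_items_by_size[OF A(1), where g = "\<lambda>a. a"] y by (simp_all add: x_def x'_def mult.commute)
  ultimately show ?thesis
    by (simp add: m_def Q_def)
qed


subsection \<open>Sums over i.i.d. items\<close>

lemma set_iid_items:
  "set_pmf (iid_items n p) = {y. (\<forall>i<n. y i \<in> set_pmf p) \<and> (\<forall>i\<ge>n. y i = 0)}"
  by (auto simp: iid_items_def set_Pi_pmf PiE_dflt_def not_less)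

lemma finite_set_iid_items: "finite (set_pmf p) \<Longrightarrow> finite (set_pmf (iid_items n p))"
  by (auto simp: iid_items_def set_Pi_pmf intro!: finite_PiE_dflt)

lemma expectation_iid_component:
  fixes g :: "real \<Rightarrow> real"
  assumes "i < n"
  shows "measure_pmf.expectation (iid_items n p) (\<lambda>y. g (y i)) = measure_pmf.expectation p g"
proof -
  have "measure_pmf.expectation p g =
      measure_pmf.expectation (map_pmf (\<lambda>y. y i) (iid_items n p)) g"
    using assms by (simp add: iid_items_def Pi_pmf_component)
  then show ?thesis by simp
qed

text \<open>The index set is left free because two cases are used: pairs, for vanishing covariances,
  and all items, for the moment generating function of a sum.\<close>

lemma expectation_iid_prod:
  fixes g :: "nat \<Rightarrow> real \<Rightarrow> real"
  assumes fin: "finite (set_pmf p)" and I: "I \<subseteq> {..<n}"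
  shows "measure_pmf.expectation (iid_items n p) (\<lambda>y. \<Prod>i\<in>I. g i (y i)) =
    (\<Prod>i\<in>I. measure_pmf.expectation p (g i))"
proof -
  have "prob_space.indep_vars (iid_items n p) (\<lambda>_. count_space UNIV) (\<lambda>i y. y i) {..<n}"
    unfolding iid_items_def by (rule indep_vars_Pi_pmf) simp
  then have "prob_space.indep_vars (iid_items n p) (\<lambda>_. count_space UNIV) (\<lambda>i y. y i) I"
    by (rule prob_space.indep_vars_subset[OF measure_pmf.prob_space_axioms]) (rule I)
  then have "prob_space.indep_vars (iid_items n p) (\<lambda>_. borel) (\<lambda>i y. g i (y i)) I"
    by (rule prob_space.indep_vars_compose2[OF measure_pmf.prob_space_axioms]) simp
  then have "measure_pmf.expectation (iid_items n p) (\<lambda>y. \<Prod>i\<in>I. g i (y i)) =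
      (\<Prod>i\<in>I. measure_pmf.expectation (iid_items n p) (\<lambda>y. g i (y i)))"
    using I finite_set_iid_items[OF fin]
    by (intro prob_space.indep_vars_lebesgue_integral[OF measure_pmf.prob_space_axioms])
      (auto intro: finite_subset integrable_measure_pmf_finite)
  also have "\<dots> = (\<Prod>i\<in>I. measure_pmf.expectation p (g i))"
    using I by (intro prod.cong expectation_iid_component) auto
  finally show ?thesis .
qed

lemma expectation_iid_sum:
  fixes g :: "real \<Rightarrow> real"
  assumes fin: "finite (set_pmf p)"
  shows "measure_pmf.expectation (iid_items n p) (\<lambda>y. \<Sum>i<n. g (y i)) =
    n * measure_pmf.expectation p g"
  using finite_set_iid_items[OF fin]
  by (subst Bochner_Integration.integral_sum)
    (auto simp: expectation_iid_component intro: integrable_measure_pmf_finite)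

lemma expectation_iid_centered_sum_square:
  fixes g :: "real \<Rightarrow> real"
  assumes fin: "finite (set_pmf p)" and "measure_pmf.expectation p g = 0"
  shows "measure_pmf.expectation (iid_items n p) (\<lambda>y. (\<Sum>i<n. g (y i))\<^sup>2) =
    n * measure_pmf.expectation p (\<lambda>x. (g x)\<^sup>2)"
proof -
  let ?E = "measure_pmf.expectation (iid_items n p)"
  have int: "integrable (iid_items n p) h" for h :: "_ \<Rightarrow> real"
    using finite_set_iid_items[OF fin] by (rule integrable_measure_pmf_finite)
  have pair: "?E (\<lambda>y. g (y i) * g (y j)) =
      (if j = i then measure_pmf.expectation p (\<lambda>x. (g x)\<^sup>2) else 0)" if "i < n" "j < n" for i j
  proof (cases "j = i")
    case True
    then show ?thesis
      using expectation_iid_component[OF that(1), of _ "\<lambda>x. (g x)\<^sup>2"] by (simp add: power2_eq_square)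
  next
    case False
    then show ?thesis
      using expectation_iid_prod[OF fin, of "{i, j}" n "\<lambda>_. g"] that assms(2) by simp
  qed
  have "?E (\<lambda>y. (\<Sum>i<n. g (y i))\<^sup>2) = (\<Sum>i<n. \<Sum>j<n. ?E (\<lambda>y. g (y i) * g (y j)))"
    by (simp add: power2_eq_square sum_product Bochner_Integration.integral_sum int)
  also have "\<dots> = (\<Sum>i<n. \<Sum>j<n. if j = i then measure_pmf.expectation p (\<lambda>x. (g x)\<^sup>2) else 0)"
    using pair by (intro sum.cong) auto
  finally show ?thesis by simp
qed

section \<open>A Bernstein-type tail bound\<close>

text \<open>For negative \<open>x\<close>, \<open>exp (- x)\<close> is at least
  \<open>1 - x + x\<^sup>2 / 2\<close>, and the product of this polynomial with
  \<open>1 + x + x\<^sup>2\<close> is at least 1; dividing by \<open>exp (- x)\<close> gives the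
  bound.\<close>

lemma exp_le_quadratic:
  fixes x :: real
  assumes "x \<le> 1"
  shows "exp x \<le> 1 + x + x\<^sup>2"
proof (cases "0 \<le> x")
  case True
  then show ?thesis using assms by (rule exp_bound)
next
  case False
  have "0 \<le> (2 * x + 1)\<^sup>2" by simp
  then have pos: "0 < 1 + x + x\<^sup>2" by (simp add: power2_eq_square algebra_simps)
  have "1 \<le> (1 + x + x\<^sup>2) * (1 + (- x) + (- x)\<^sup>2 / 2)"
  proof -
    have "0 \<le> x\<^sup>2 * (1 - x + x\<^sup>2) / 2" using False by simp
    moreover have "(1 + x + x\<^sup>2) * (1 + (- x) + (- x)\<^sup>2 / 2) = 1 + x\<^sup>2 * (1 - x + x\<^sup>2) / 2"
      by (simp add: power2_eq_square field_simps)
    ultimately show ?thesis by simp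
  qed
  also have "\<dots> \<le> (1 + x + x\<^sup>2) * exp (- x)"
    using False pos by (intro mult_left_mono exp_lower_Taylor_quadratic) auto
  finally show ?thesis by (simp add: exp_minus field_simps)
qed

text \<open>Markov's inequality for the exponential of \<open>X\<close>.\<close>

lemma prob_le_of_expectation_exp:
  fixes X :: "'a \<Rightarrow> real"
  assumes fin: "finite (set_pmf M)"
  shows "measure_pmf.prob M {y. s \<le> X y} \<le> exp (- s) * measure_pmf.expectation M (\<lambda>y. exp (X y))"
proof -
  have int: "integrable M h" for h :: "_ \<Rightarrow> real"
    using fin by (rule integrable_measure_pmf_finite)
  have "measure_pmf.prob M {y. s \<le> X y} = measure_pmf.expectation M (indicator {y. s \<le> X y})"
    by simp
  also have "\<dots> \<le> measure_pmf.expectation M (\<lambda>y. exp (X y - s))"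
    by (intro integral_mono int) (auto simp: indicator_def)
  also have "\<dots> = exp (- s) * measure_pmf.expectation M (\<lambda>y. exp (X y))"
    by (subst Bochner_Integration.integral_mult_right_zero[symmetric]) (simp add: exp_diff exp_minus field_simps)
  finally show ?thesis .
qed

text \<open>Chernoff's method. The parameter \<open>l = s / (2 * (n * w))\<close> minimises
  \<open>- l * s + n * l\<^sup>2 * w\<close>, and the upper limit on \<open>s\<close> ensures
  \<open>l \<le> 1\<close>, so that the quadratic bound on \<open>exp\<close> applies to
  \<open>l * g x\<close>.\<close>

lemma iid_sum_tail_one_sided:
  fixes g :: "real \<Rightarrow> real"
  assumes fin: "finite (set_pmf p)" and mean: "measure_pmf.expectation p g = 0"
    and bound: "\<And>x. x \<in> set_pmf p \<Longrightarrow> \<bar>g x\<bar> \<le> 1"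
    and var: "measure_pmf.expectation p (\<lambda>x. (g x)\<^sup>2) \<le> w" and w: "0 < w"
    and s: "0 \<le> s" "s \<le> 2 * (n * w)" and n: "0 < n"
  shows "measure_pmf.prob (iid_items n p) {y. s \<le> (\<Sum>i<n. g (y i))} \<le> exp (- s\<^sup>2 / (4 * (n * w)))"
proof -
  define l where "l = s / (2 * (n * w))"
  have nw: "0 < n * w" using n w by simp
  have l: "0 \<le> l" "l \<le> 1" using s nw by (auto simp: l_def field_simps)
  have int: "integrable p h" for h :: "_ \<Rightarrow> real"
    using fin by (rule integrable_measure_pmf_finite)
  have "measure_pmf.expectation p (\<lambda>x. exp (l * g x)) \<le>
      measure_pmf.expectation p (\<lambda>x. 1 + l * g x + l\<^sup>2 * (g x)\<^sup>2)"
  proof (intro integral_mono_AE int AE_pmfI)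
    fix x assume "x \<in> set_pmf p"
    then have "l * \<bar>g x\<bar> \<le> 1" using l bound by (intro mult_le_one) auto
    moreover have "l * g x \<le> l * \<bar>g x\<bar>" using l by (intro mult_left_mono) auto
    ultimately have "l * g x \<le> 1" by simp
    then show "exp (l * g x) \<le> 1 + l * g x + l\<^sup>2 * (g x)\<^sup>2"
      using exp_le_quadratic[of "l * g x"] by (simp add: power_mult_distrib)
  qed
  also have "\<dots> = 1 + l\<^sup>2 * measure_pmf.expectation p (\<lambda>x. (g x)\<^sup>2)"
    using mean by (simp add: int)
  also have "\<dots> \<le> 1 + l\<^sup>2 * w" using var by (intro add_left_mono mult_left_mono) auto
  also have "\<dots> \<le> exp (l\<^sup>2 * w)" by (rule exp_ge_add_one_self)
  finally have mgf: "measure_pmf.expectation p (\<lambda>x. exp (l * g x)) \<le> exp (l\<^sup>2 * w)" .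
  have "measure_pmf.prob (iid_items n p) {y. s \<le> (\<Sum>i<n. g (y i))} \<le>
      measure_pmf.prob (iid_items n p) {y. l * s \<le> l * (\<Sum>i<n. g (y i))}"
    using l by (intro measure_pmf.finite_measure_mono) (auto intro: mult_left_mono)
  also have "\<dots> \<le> exp (- (l * s)) *
      measure_pmf.expectation (iid_items n p) (\<lambda>y. exp (l * (\<Sum>i<n. g (y i))))"
    by (intro prob_le_of_expectation_exp finite_set_iid_items fin)
  also have "measure_pmf.expectation (iid_items n p) (\<lambda>y. exp (l * (\<Sum>i<n. g (y i)))) =
      measure_pmf.expectation p (\<lambda>x. exp (l * g x)) ^ n"
    using expectation_iid_prod[OF fin order_refl, of n "\<lambda>_ x. exp (l * g x)"]
    by (simp add: sum_distrib_left exp_sum)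
  also have "exp (- (l * s)) * \<dots> \<le> exp (- (l * s)) * exp (l\<^sup>2 * w) ^ n"
    using mgf by (intro mult_left_mono power_mono) auto
  also have "\<dots> = exp (- (l * s) + n * (l\<^sup>2 * w))"
    by (simp only: exp_add exp_of_nat_mult)
  also have "- (l * s) + n * (l\<^sup>2 * w) = - s\<^sup>2 / (4 * (n * w))"
    using w n by (simp add: l_def power2_eq_square field_simps)
  finally show ?thesis .
qed

lemma iid_sum_tail:
  fixes g :: "real \<Rightarrow> real"
  assumes fin: "finite (set_pmf p)" and mean: "measure_pmf.expectation p g = 0"
    and bound: "\<And>x. x \<in> set_pmf p \<Longrightarrow> \<bar>g x\<bar> \<le> 1"
    and var: "measure_pmf.expectation p (\<lambda>x. (g x)\<^sup>2) \<le> w" and w: "0 < w"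
    and s: "0 \<le> s" "s \<le> 2 * (n * w)" and n: "0 < n"
  shows "measure_pmf.prob (iid_items n p) {y. s \<le> \<bar>\<Sum>i<n. g (y i)\<bar>} \<le>
    2 * exp (- s\<^sup>2 / (4 * (n * w)))"
proof -
  let ?P = "measure_pmf.prob (iid_items n p)"
  have "{y. s \<le> \<bar>\<Sum>i<n. g (y i)\<bar>} =
      {y. s \<le> (\<Sum>i<n. g (y i))} \<union> {y. s \<le> (\<Sum>i<n. - g (y i))}"
    by (auto simp: sum_negf)
  then have "?P {y. s \<le> \<bar>\<Sum>i<n. g (y i)\<bar>} \<le>
      ?P {y. s \<le> (\<Sum>i<n. g (y i))} + ?P {y. s \<le> (\<Sum>i<n. - g (y i))}"
    by (simp add: measure_Un_le)
  also have "\<dots> \<le> exp (- s\<^sup>2 / (4 * (n * w))) + exp (- s\<^sup>2 / (4 * (n * w)))"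
    using assms by (intro add_mono iid_sum_tail_one_sided) auto
  finally show ?thesis by simp
qed


subsection \<open>Concentration\<close>

locale admissible =
  fixes n r :: nat and p :: "real pmf"
  assumes n_ge: "2 \<le> n" and adm: "admissible_law n r p"
begin

abbreviation "A \<equiv> set_pmf p"
abbreviation "\<mu> \<equiv> item_mean p"
abbreviation "L \<equiv> ln (real n)"
abbreviation "V \<equiv> real n * (\<mu> ^ 3 + item_var p)"
abbreviation "E \<equiv> measure_pmf.expectation (iid_items n p)"
abbreviation "P \<equiv> measure_pmf.prob (iid_items n p)"
abbreviation "M2 \<equiv> measure_pmf.expectation p (\<lambda>x. x\<^sup>2)"

section \<open>Moment bounds for an admissible law\<close>

lemma fin: "finite A" and card_atoms: "card A = r" and atoms: "A \<subseteq> {0<..<1}"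
  and prob_atom: "\<And>a. a \<in> A \<Longrightarrow> 1 / L \<le> pmf p a"
  using adm by (auto simp: admissible_law_def)

lemma L_pos: "0 < L" using n_ge by simp

lemma int: "integrable (iid_items n p) (h :: _ \<Rightarrow> real)"
  by (intro integrable_measure_pmf_finite finite_set_iid_items fin)

lemma intp: "integrable p (h :: _ \<Rightarrow> real)"
  by (intro integrable_measure_pmf_finite fin)

lemma expectation_atoms: "measure_pmf.expectation p h = (\<Sum>a\<in>A. pmf p a * h a)" for h :: "real \<Rightarrow> real"
  using fin by (subst integral_measure_pmf[of A]) auto

lemma r_pos: "0 < r"
  using card_atoms fin set_pmf_not_empty[of p] by (metis card_gt_0_iff)

lemma prob_pos: "a \<in> A \<Longrightarrow> 0 < pmf p a"
  by (simp add: pmf_positive)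

lemma mean_pos: "0 < \<mu>"
proof -
  have "0 < (\<Sum>a\<in>A. pmf p a * a)"
    using atoms prob_pos fin set_pmf_not_empty[of p] by (intro sum_pos) auto
  then show ?thesis by (simp add: item_mean_def expectation_atoms)
qed

lemma mean_L: "\<mu> * L \<le> 1"
proof -
  have "1 \<le> (real r)\<^sup>2" using r_pos by simp
  then have "1 / ((real r)\<^sup>2 * L) \<le> 1 / (1 * L)"
    using L_pos r_pos by (intro divide_left_mono mult_right_mono) auto
  then have "\<mu> \<le> 1 / L" using adm by (simp add: admissible_law_def)
  then show ?thesis using L_pos by (simp add: field_simps)
qed

lemma mean_less_1: "\<mu> < 1"
proof -
  have "measure_pmf.expectation p (\<lambda>x. x) < 1"
  proof -
    have "(\<Sum>a\<in>A. pmf p a * a) < (\<Sum>a\<in>A. pmf p a * 1)"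
      using atoms prob_pos fin set_pmf_not_empty[of p]
      by (intro sum_strict_mono mult_strict_left_mono) auto
    then show ?thesis
      using expectation_atoms[of "\<lambda>_. 1"] by (simp add: expectation_atoms)
  qed
  then show ?thesis by (simp add: item_mean_def)
qed

text \<open>A single atom contributes \<open>pmf p a * a\<close>, which is at least
  \<open>a / L\<close>, to the mean.\<close>

lemma atom_le: "a \<in> A \<Longrightarrow> a \<le> \<mu> * L"
proof -
  assume a: "a \<in> A"
  have "1 / L * a \<le> pmf p a * a"
    using prob_atom[OF a] a atoms by (intro mult_right_mono) auto
  also have "\<dots> \<le> (\<Sum>a\<in>A. pmf p a * a)"
    using a fin atoms by (intro member_le_sum) (auto intro: less_imp_le)
  also have "\<dots> = \<mu>" by (simp add: item_mean_def expectation_atoms)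
  finally show "a \<le> \<mu> * L" using L_pos by (simp add: field_simps)
qed

lemma M2_pos: "0 < M2"
proof -
  have "0 < (\<Sum>a\<in>A. pmf p a * a\<^sup>2)"
    using atoms prob_pos fin set_pmf_not_empty[of p] by (intro sum_pos) auto
  then show ?thesis by (simp add: expectation_atoms)
qed

lemma M2_eq: "M2 = \<mu>\<^sup>2 + item_var p"
  by (simp add: item_var_def item_mean_def measure_pmf.variance_eq intp)

lemma var_nonneg: "0 \<le> item_var p"
  by (simp add: item_var_def)

text \<open>The second moment is at most the largest atom times the mean, hence at most
  \<open>\<mu>\<^sup>2 * L\<close>.\<close>

lemma M2_L: "M2 * L \<le> 1"
proof -
  have "(\<Sum>a\<in>A. pmf p a * a\<^sup>2) \<le> (\<Sum>a\<in>A. pmf p a * a * (\<mu> * L))"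
  proof (intro sum_mono)
    fix a assume a: "a \<in> A"
    have "a * a \<le> a * (\<mu> * L)" using atom_le[OF a] a atoms by (intro mult_left_mono) auto
    then have "pmf p a * (a * a) \<le> pmf p a * (a * (\<mu> * L))" by (rule mult_left_mono) simp
    then show "pmf p a * a\<^sup>2 \<le> pmf p a * a * (\<mu> * L)" by (simp only: power2_eq_square mult.assoc)
  qed
  also have "\<dots> = \<mu> * (\<mu> * L)"
    by (simp add: item_mean_def expectation_atoms sum_distrib_right)
  finally have "M2 * L \<le> \<mu> * (\<mu> * L) * L"
    using L_pos by (simp add: expectation_atoms)
  also have "\<dots> = (\<mu> * L)\<^sup>2" by (simp add: power2_eq_square)
  also have "\<dots> \<le> 1" using mean_L mean_pos L_pos by (intro power_le_one) auto
  finally show ?thesis .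
qed

lemma V_pos: "0 < V"
  using mean_pos var_nonneg n_ge by (intro mult_pos_pos add_pos_nonneg) auto

text \<open>The squared second moment is at most twice \<open>\<mu> ^ 4\<close> plus twice the
  squared variance. The factor \<open>L\<close> absorbs one power of the mean in the first term and
  one power of the variance in the second; this is how the cube of the mean arises.\<close>

lemma M2_square_L: "M2\<^sup>2 * L \<le> 2 * (\<mu> ^ 3 + item_var p)"
proof -
  have "\<mu> ^ 4 * L \<le> \<mu> ^ 3 * 1"
    using mean_L mean_pos
    by (simp only: power_Suc2[of \<mu> 3, simplified] mult.assoc) (intro mult_left_mono, auto)
  moreover have "(item_var p)\<^sup>2 * L \<le> item_var p * 1"
  proof -
    have "item_var p * L \<le> M2 * L"
      using L_pos by (intro mult_right_mono) (auto simp: M2_eq)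
    with M2_L have "item_var p * L \<le> 1" by simp
    then have "item_var p * (item_var p * L) \<le> item_var p * 1"
      using var_nonneg by (rule mult_left_mono)
    then show ?thesis by (simp add: power2_eq_square mult.assoc)
  qed
  moreover have "M2\<^sup>2 \<le> 2 * \<mu> ^ 4 + 2 * (item_var p)\<^sup>2"
    using zero_le_power2[of "\<mu>\<^sup>2 - item_var p"]
    unfolding M2_eq by (simp add: power2_eq_square power4_eq_xxxx algebra_simps)
  then have "M2\<^sup>2 * L \<le> (2 * \<mu> ^ 4 + 2 * (item_var p)\<^sup>2) * L"
    using L_pos by (intro mult_right_mono) auto
  ultimately show ?thesis by (simp add: algebra_simps)
qed

text \<open>For \<open>t < V\<close> this keeps \<open>t\<^sup>2 / V\<close> of order
  \<open>n / L\<close>, the order of the exponent in the probability of an unbalanced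
  sample.\<close>

lemma V_le: "V \<le> 2 * (n / L)"
proof -
  have "\<mu> ^ 3 \<le> \<mu> ^ 1"
    using mean_pos mean_less_1 by (intro power_decreasing) auto
  moreover have "\<mu> \<le> 1 / L" using mean_L L_pos by (simp add: field_simps)
  moreover have "item_var p \<le> 1 / L"
  proof -
    have "M2 \<le> 1 / L" using M2_L L_pos by (simp add: field_simps)
    then show ?thesis by (simp add: M2_eq) (smt (verit) zero_le_power2)
  qed
  ultimately have "\<mu> ^ 3 + item_var p \<le> 2 / L" by simp
  then have "V \<le> n * (2 / L)" by (intro mult_left_mono) auto
  also have "\<dots> = 2 * (n / L)" by simp
  finally show ?thesis .
qed

text \<open>
  The number of bins changes by at most the change of the total size plus, for every atom \<open>a\<close>,
  a multiple of \<open>M2 / pmf p a\<close> times the change of the number of items of size \<open>a\<close>.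
  The functions below are the corresponding centred summands, with \<open>None\<close> for the total size.
\<close>

definition dev :: "real option \<Rightarrow> real \<Rightarrow> real" where
  "dev k x = (case k of None \<Rightarrow> x - \<mu>
     | Some a \<Rightarrow> 10 * M2 / pmf p a * (indicator {a} x - pmf p a))"

abbreviation "K \<equiv> insert None (Some ` A)"

definition total_dev :: "(nat \<Rightarrow> real) \<Rightarrow> real" where
  "total_dev y = (\<Sum>k\<in>K. \<bar>\<Sum>i<n. dev k (y i)\<bar>)"

text \<open>The lower limit controls the divisor \<open>x a\<close> in
  \<open>min_bins_change\<close>, the upper one the sum of the squared sizes.\<close>

definition balanced :: "(nat \<Rightarrow> real) \<Rightarrow> bool" where
  "balanced y \<longleftrightarrow> (\<forall>a\<in>A. n * pmf p a / 2 \<le> item_count n y a \<and> item_count n y a \<le> 2 * (n * pmf p a))"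

lemma card_K: "finite K" "card K = Suc r"
  using fin by (simp_all add: card_image card_atoms)

lemma total_dev_nonneg: "0 \<le> total_dev y"
  by (auto simp: total_dev_def intro: sum_nonneg)

lemma expectation_indicator: "measure_pmf.expectation p (indicator {a}) = pmf p a"
  by (simp add: pmf.rep_eq)

lemma expectation_centred_indicator_square:
  "measure_pmf.expectation p (\<lambda>x. (indicator {a} x - pmf p a)\<^sup>2) \<le> pmf p a"
proof -
  have "measure_pmf.expectation p (\<lambda>x. (indicator {a} x - pmf p a)\<^sup>2) =
      measure_pmf.expectation p (\<lambda>x. indicator {a} x * (1 - 2 * pmf p a) + (pmf p a)\<^sup>2)"
    by (intro Bochner_Integration.integral_cong) (auto simp: indicator_def power2_eq_square algebra_simps)
  also have "\<dots> = pmf p a * (1 - 2 * pmf p a) + (pmf p a)\<^sup>2"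
    by (subst Bochner_Integration.integral_add)
      (simp_all add: intp expectation_indicator measure_pmf_single)
  also have "\<dots> \<le> pmf p a" by (simp add: power2_eq_square algebra_simps)
  finally show ?thesis .
qed

lemma expectation_dev: "measure_pmf.expectation p (dev k) = 0"
  by (cases k) (simp_all add: dev_def[abs_def] intp item_mean_def measure_pmf_single)

text \<open>Since \<open>M2 \<le> 1 / L \<le> pmf p a\<close>, the coefficient of the centred
  indicator is at most 10.\<close>

lemma dev_bound:
  assumes "k \<in> K" "x \<in> A"
  shows "\<bar>dev k x\<bar> \<le> 10"
proof (cases k)
  case None
  then show ?thesis
    using assms atoms mean_pos mean_less_1 by (force simp: dev_def abs_le_iff)
next
  case (Some a)
  then have a: "a \<in> A" using assms by auto
  have "M2 \<le> 1 / L" using M2_L L_pos by (simp add: field_simps)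
  with prob_atom[OF a] have "M2 \<le> pmf p a" by linarith
  then have "10 * M2 / pmf p a \<le> 10"
    using prob_pos[OF a] by (simp add: pos_divide_le_eq)
  then have "10 * M2 / pmf p a * \<bar>indicator {a} x - pmf p a\<bar> \<le> 10 * 1"
    using M2_pos prob_pos[OF a] pmf_le_1[of p a]
    by (intro mult_mono) (auto simp: indicator_def)
  then show ?thesis
    using Some M2_pos prob_pos[OF a] by (simp add: dev_def abs_mult)
qed

text \<open>For an atom the second moment is at most \<open>100 * M2\<^sup>2 / pmf p a\<close>,
  hence at most \<open>100 * (M2\<^sup>2 * L)\<close>, to which \<open>M2_square_L\<close>
  applies.\<close>

lemma dev_square:
  assumes "k \<in> K"
  shows "measure_pmf.expectation p (\<lambda>x. (dev k x)\<^sup>2) \<le> 200 * (\<mu> ^ 3 + item_var p)"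
proof (cases k)
  case None
  have "measure_pmf.expectation p (\<lambda>x. (dev k x)\<^sup>2) = item_var p"
    by (simp add: None dev_def item_var_def item_mean_def)
  also have "\<dots> \<le> 200 * (\<mu> ^ 3 + item_var p)"
    using var_nonneg mean_pos by (simp add: add_nonneg_nonneg)
  finally show ?thesis .
next
  case (Some a)
  then have a: "a \<in> A" using assms by auto
  have pa: "0 < pmf p a" by (rule prob_pos[OF a])
  have "measure_pmf.expectation p (\<lambda>x. (dev k x)\<^sup>2) =
      (10 * M2 / pmf p a)\<^sup>2 * measure_pmf.expectation p (\<lambda>x. (indicator {a} x - pmf p a)\<^sup>2)"
    unfolding Some dev_def option.case power_mult_distrib
    by (rule Bochner_Integration.integral_mult_right_zero)
  also have "\<dots> \<le> (10 * M2 / pmf p a)\<^sup>2 * pmf p a"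
    by (intro mult_left_mono expectation_centred_indicator_square) auto
  also have "\<dots> = 100 * (M2\<^sup>2 * (1 / pmf p a))"
    using pa by (simp add: power2_eq_square field_simps)
  also have "\<dots> \<le> 100 * (M2\<^sup>2 * L)"
  proof -
    have "1 / pmf p a \<le> L" using prob_atom[OF a] pa L_pos by (simp add: field_simps)
    then show ?thesis by (intro mult_left_mono) auto
  qed
  also have "\<dots> \<le> 200 * (\<mu> ^ 3 + item_var p)" using M2_square_L by simp
  finally show ?thesis .
qed

lemma sum_dev_None: "(\<Sum>i<n. dev None (y i)) = (\<Sum>i<n. y i) - n * \<mu>"
  by (simp add: dev_def sum_subtractf)

lemma sum_indicator_eq_item_count: "(\<Sum>i<n. indicator {a} (y i) :: real) = item_count n y a"
proof -
  have "(\<Sum>i<n. indicator {a} (y i) :: real) = (\<Sum>i\<in>{..<n}. if y i = a then 1 else 0)"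
    by (intro sum.cong) (auto simp: indicator_def)
  also have "\<dots> = item_count n y a"
    by (subst sum.inter_filter[symmetric]) (auto simp: item_count_def)
  finally show ?thesis .
qed

lemma sum_dev_Some:
  "(\<Sum>i<n. dev (Some a) (y i)) = 10 * M2 / pmf p a * (item_count n y a - n * pmf p a)"
  unfolding dev_def option.case sum_distrib_left[symmetric]
  by (simp add: sum_subtractf sum_indicator_eq_item_count)

lemma total_dev_eq:
  "total_dev y = \<bar>(\<Sum>i<n. y i) - n * \<mu>\<bar> +
     (\<Sum>a\<in>A. 10 * M2 / pmf p a * \<bar>item_count n y a - n * pmf p a\<bar>)"
proof -
  have "total_dev y = \<bar>\<Sum>i<n. dev None (y i)\<bar> + (\<Sum>k\<in>Some ` A. \<bar>\<Sum>i<n. dev k (y i)\<bar>)"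
    unfolding total_dev_def using fin by (subst sum.insert) auto
  also have "(\<Sum>k\<in>Some ` A. \<bar>\<Sum>i<n. dev k (y i)\<bar>) = (\<Sum>a\<in>A. \<bar>\<Sum>i<n. dev (Some a) (y i)\<bar>)"
    by (subst sum.reindex) auto
  also have "\<dots> = (\<Sum>a\<in>A. 10 * M2 / pmf p a * \<bar>item_count n y a - n * pmf p a\<bar>)"
  proof (intro sum.cong refl)
    fix a
    have "0 \<le> 10 * M2 / pmf p a" using M2_pos by simp
    then show "\<bar>\<Sum>i<n. dev (Some a) (y i)\<bar> = 10 * M2 / pmf p a * \<bar>item_count n y a - n * pmf p a\<bar>"
      unfolding sum_dev_Some abs_mult by simp
  qed
  finally show ?thesis by (simp add: sum_dev_None)
qed

text \<open>Balance of \<open>y\<close> turns the random coefficients of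
  \<open>min_bins_change\<close> into the constants in \<open>dev\<close>. The differences between
  \<open>y\<close> and \<open>y'\<close> are then split by the triangle inequality through the
  expected counts and the expected total size.\<close>

lemma min_bins_diff_le:
  assumes y: "\<forall>i<n. y i \<in> A" "balanced y" and y': "\<forall>i<n. y' i \<in> A"
  shows "real (min_bins n y') - real (min_bins n y) \<le> total_dev y + total_dev y' + 3 * real r"
proof -
  define Q where "Q = (\<Sum>i<n. (y i)\<^sup>2)"
  have A1: "A \<subseteq> {0<..1}" using atoms by force
  have n0: "0 < real n" using n_ge by simp
  have Q: "Q \<le> 2 * (n * M2)"
  proof -
    have "Q = (\<Sum>a\<in>A. item_count n y a * a\<^sup>2)"
      unfolding Q_def by (rule sum_items_by_size[OF fin y(1)])
    also have "\<dots> \<le> (\<Sum>a\<in>A. 2 * (n * pmf p a) * a\<^sup>2)"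
      using y(2) by (intro sum_mono mult_right_mono) (auto simp: balanced_def)
    also have "\<dots> = 2 * (n * M2)"
      by (simp add: expectation_atoms sum_distrib_left mult.assoc)
    finally show ?thesis .
  qed
  \<comment> \<open>The constant 10 is 2 + 8: \<open>pmf p a * a\<^sup>2\<close> is one summand of
    \<open>M2\<close>, and \<open>Q \<le> 2 * (n * M2)\<close> is divided by a count of at least
    \<open>n * pmf p a / 2\<close>.\<close>
  have coeff: "2 * a\<^sup>2 + 2 * Q / item_count n y a \<le> 10 * M2 / pmf p a" if a: "a \<in> A" for a
  proof -
    have pa: "0 < pmf p a" by (rule prob_pos[OF a])
    have "pmf p a * a\<^sup>2 \<le> M2"
      unfolding expectation_atoms using a fin by (intro member_le_sum) auto
    then have c1: "2 * a\<^sup>2 \<le> 2 * M2 / pmf p a" using pa by (simp add: field_simps)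
    have "2 * Q / item_count n y a \<le> 2 * (2 * (n * M2)) / (n * pmf p a / 2)"
      using y(2) a pa n0 Q M2_pos by (intro frac_le) (auto simp: balanced_def)
    also have "\<dots> = 8 * M2 / pmf p a"
      using n0 pa by (simp add: field_simps)
    finally have c2: "2 * Q / item_count n y a \<le> 8 * M2 / pmf p a" .
    have "2 * M2 / pmf p a + 8 * M2 / pmf p a = 10 * M2 / pmf p a"
      by (simp flip: add_divide_distrib)
    then show ?thesis using add_mono[OF c1 c2] by simp
  qed
  have "real (min_bins n y') \<le> real (min_bins n y) + ((\<Sum>i<n. y' i) - (\<Sum>i<n. y i)) +
      (\<Sum>a\<in>A. (2 * a\<^sup>2 + 2 * Q / item_count n y a) *
         \<bar>real (item_count n y' a) - real (item_count n y a)\<bar>) + 3 * card A"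
    unfolding Q_def by (rule min_bins_change[OF fin A1 y(1) y'])
  also have "\<dots> \<le> real (min_bins n y) + ((\<Sum>i<n. y' i) - (\<Sum>i<n. y i)) +
      (\<Sum>a\<in>A. 10 * M2 / pmf p a * \<bar>item_count n y a - n * pmf p a\<bar> +
        10 * M2 / pmf p a * \<bar>item_count n y' a - n * pmf p a\<bar>) + 3 * card A"
  proof (intro add_mono order_refl sum_mono)
    fix a assume a: "a \<in> A"
    have "(2 * a\<^sup>2 + 2 * Q / item_count n y a) * \<bar>real (item_count n y' a) - real (item_count n y a)\<bar>
      \<le> 10 * M2 / pmf p a * (\<bar>item_count n y a - n * pmf p a\<bar> + \<bar>item_count n y' a - n * pmf p a\<bar>)"
      using M2_pos by (intro mult_mono coeff a) auto
    then show "(2 * a\<^sup>2 + 2 * Q / item_count n y a) * \<bar>real (item_count n y' a) - real (item_count n y a)\<bar>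
      \<le> 10 * M2 / pmf p a * \<bar>item_count n y a - n * pmf p a\<bar> +
        10 * M2 / pmf p a * \<bar>item_count n y' a - n * pmf p a\<bar>"
      by (simp only: distrib_left)
  qed
  finally show ?thesis
    unfolding total_dev_eq sum.distrib by (simp add: card_atoms)
qed

lemma min_bins_abs_diff_le:
  assumes "\<forall>i<n. y i \<in> A" "balanced y" "\<forall>i<n. y' i \<in> A" "balanced y'"
  shows "\<bar>real (min_bins n y) - real (min_bins n y')\<bar> \<le> total_dev y + total_dev y' + 3 * real r"
  using min_bins_diff_le[of y y'] min_bins_diff_le[of y' y] assms by (simp add: abs_le_iff)

section \<open>Mean and tails of the deviations\<close>

text \<open>Each of the \<open>Suc r\<close> sums has second moment at most \<open>200 * V\<close>.
  The arithmetic-geometric mean inequality, scaled by \<open>sqrt V\<close>, turns this into a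
  first-moment bound of at most \<open>101 * sqrt V\<close>.\<close>

lemma expectation_total_dev: "E total_dev \<le> 101 * real (Suc r) * sqrt V"
proof -
  define S where "S = sqrt V"
  have s: "0 < S" using V_pos by (simp add: S_def)
  have V: "V = S\<^sup>2" unfolding S_def using V_pos by (intro real_sqrt_pow2[symmetric]) simp
  have "E (\<lambda>y. \<bar>\<Sum>i<n. dev k (y i)\<bar>) \<le> 101 * S" if k: "k \<in> K" for k
  proof -
    have sq: "E (\<lambda>y. (\<Sum>i<n. dev k (y i))\<^sup>2) \<le> 200 * V"
    proof -
      have "E (\<lambda>y. (\<Sum>i<n. dev k (y i))\<^sup>2) = n * measure_pmf.expectation p (\<lambda>x. (dev k x)\<^sup>2)"
        by (rule expectation_iid_centered_sum_square[OF fin expectation_dev])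
      also have "\<dots> \<le> n * (200 * (\<mu> ^ 3 + item_var p))"
        by (intro mult_left_mono dev_square k) auto
      also have "\<dots> = 200 * V" by (rule mult.left_commute)
      finally show ?thesis .
    qed
    have amgm: "\<bar>x\<bar> \<le> S / 2 + x\<^sup>2 / (2 * S)" for x
    proof -
      have "0 \<le> (\<bar>x\<bar> - S)\<^sup>2" by simp
      then have "2 * \<bar>x\<bar> * S \<le> S\<^sup>2 + x\<^sup>2"
        by (simp add: power2_diff)
      then show ?thesis using s by (simp add: field_simps power2_eq_square)
    qed
    have "E (\<lambda>y. \<bar>\<Sum>i<n. dev k (y i)\<bar>) \<le> E (\<lambda>y. S / 2 + (\<Sum>i<n. dev k (y i))\<^sup>2 / (2 * S))"
      by (intro integral_mono int amgm)
    also have "\<dots> = S / 2 + E (\<lambda>y. (\<Sum>i<n. dev k (y i))\<^sup>2) / (2 * S)"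
      by (subst Bochner_Integration.integral_add) (simp_all add: int)
    also have "\<dots> \<le> S / 2 + 200 * S\<^sup>2 / (2 * S)"
      using sq s unfolding V by (intro add_left_mono divide_right_mono) auto
    also have "200 * S\<^sup>2 / (2 * S) = 100 * S"
      using s by (simp add: power2_eq_square)
    finally show ?thesis using s by simp
  qed
  then have "(\<Sum>k\<in>K. E (\<lambda>y. \<bar>\<Sum>i<n. dev k (y i)\<bar>)) \<le> (\<Sum>k\<in>K. 101 * S)"
    by (rule sum_mono)
  also have "\<dots> = 101 * real (Suc r) * S" by (simp add: card_K del: of_nat_Suc)
  finally show ?thesis
    unfolding S_def[symmetric] total_dev_def by (subst Bochner_Integration.integral_sum) (simp_all add: int)
qed

lemma prob_total_dev:
  assumes s: "0 \<le> s" "s \<le> V"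
  shows "P {y. s \<le> total_dev y} \<le> 2 * real (Suc r) * exp (- s\<^sup>2 / (800 * (real (Suc r))\<^sup>2 * V))"
proof -
  \<comment> \<open>If the \<open>Suc r\<close> absolute sums add up to at least \<open>s\<close>,
    one of them is at least \<open>s / Suc r\<close>. The further factor 10 normalises
    \<open>dev\<close> to absolute value at most 1, which leaves second moment at most
    \<open>2 * (\<mu> ^ 3 + item_var p)\<close>.\<close>
  define q where "q = s / (10 * real (Suc r))"
  have q: "0 \<le> q" "q \<le> V"
  proof -
    show "0 \<le> q" using s by (simp add: q_def)
    have "q \<le> s / 1" unfolding q_def using s by (intro divide_left_mono) auto
    then show "q \<le> V" using s by simp
  qed
  have "{y. s \<le> total_dev y} \<subseteq> (\<Union>k\<in>K. {y. q \<le> \<bar>\<Sum>i<n. dev k (y i) / 10\<bar>})"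
  proof (rule subsetI, rule ccontr)
    fix y assume y: "y \<in> {y. s \<le> total_dev y}" "y \<notin> (\<Union>k\<in>K. {y. q \<le> \<bar>\<Sum>i<n. dev k (y i) / 10\<bar>})"
    have "total_dev y < (\<Sum>k\<in>K. 10 * q)"
      unfolding total_dev_def
    proof (rule sum_strict_mono)
      fix k assume "k \<in> K"
      then have "\<bar>\<Sum>i<n. dev k (y i) / 10\<bar> < q" using y(2) by force
      then show "\<bar>\<Sum>i<n. dev k (y i)\<bar> < 10 * q"
        by (simp flip: sum_divide_distrib)
    qed (use card_K in auto)
    also have "\<dots> = s" unfolding q_def by (simp add: card_K del: of_nat_Suc)
    finally show False using y by simp
  qed
  then have "P {y. s \<le> total_dev y} \<le> P (\<Union>k\<in>K. {y. q \<le> \<bar>\<Sum>i<n. dev k (y i) / 10\<bar>})"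
    by (intro measure_pmf.finite_measure_mono) auto
  also have "\<dots> \<le> (\<Sum>k\<in>K. P {y. q \<le> \<bar>\<Sum>i<n. dev k (y i) / 10\<bar>})"
    using card_K by (intro measure_pmf.finite_measure_subadditive_finite) auto
  also have "\<dots> \<le> (\<Sum>k\<in>K. 2 * exp (- q\<^sup>2 / (4 * (n * (2 * (\<mu> ^ 3 + item_var p))))))"
  proof (intro sum_mono iid_sum_tail fin)
    fix k assume k: "k \<in> K"
    show "measure_pmf.expectation p (\<lambda>x. dev k x / 10) = 0"
      by (simp add: expectation_dev)
    show "measure_pmf.expectation p (\<lambda>x. (dev k x / 10)\<^sup>2) \<le> 2 * (\<mu> ^ 3 + item_var p)"
      using dev_square[OF k] by (simp add: power_divide)
    show "\<bar>dev k x / 10\<bar> \<le> 1" if "x \<in> A" for x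
      using dev_bound[OF k that] by simp
    show "0 < 2 * (\<mu> ^ 3 + item_var p)"
      using mean_pos var_nonneg by (simp add: add_pos_nonneg)
    show "q \<le> 2 * (n * (2 * (\<mu> ^ 3 + item_var p)))"
      using q V_pos by (simp add: algebra_simps)
  qed (use q n_ge in auto)
  also have "\<dots> = 2 * real (Suc r) * exp (- s\<^sup>2 / (800 * (real (Suc r))\<^sup>2 * V))"
  proof -
    have "q\<^sup>2 / (4 * (n * (2 * (\<mu> ^ 3 + item_var p)))) = s\<^sup>2 / (800 * (real (Suc r))\<^sup>2 * V)"
      unfolding q_def by (simp add: power_divide power_mult_distrib mult.assoc mult.left_commute
          del: of_nat_Suc)
    then show ?thesis by (simp add: card_K del: of_nat_Suc)
  qed
  finally show ?thesis .
qed

text \<open>Leaving the factor-2 window means missing the expected count by at least half of it. The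
  tail bound with variance proxy \<open>pmf p a\<close> has exponent
  \<open>n * pmf p a / 16\<close>, which is at least \<open>n / L / 16\<close>.\<close>

lemma prob_not_balanced: "P {y. \<not> balanced y} \<le> 2 * real r * exp (- (n / L) / 16)"
proof -
  have "{y. \<not> balanced y} \<subseteq>
      (\<Union>a\<in>A. {y. n * pmf p a / 2 \<le> \<bar>\<Sum>i<n. indicator {a} (y i) - pmf p a\<bar>})"
  proof
    fix y assume "y \<in> {y. \<not> balanced y}"
    then obtain a where a: "a \<in> A"
      "\<not> (n * pmf p a / 2 \<le> item_count n y a \<and> item_count n y a \<le> 2 * (n * pmf p a))"
      by (auto simp: balanced_def)
    have "0 \<le> n * pmf p a" by simp
    with a(2) have "n * pmf p a / 2 \<le> \<bar>item_count n y a - n * pmf p a\<bar>" by linarith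
    then show "y \<in> (\<Union>a\<in>A. {y. n * pmf p a / 2 \<le> \<bar>\<Sum>i<n. indicator {a} (y i) - pmf p a\<bar>})"
      using a(1) by (auto simp: sum_subtractf sum_indicator_eq_item_count)
  qed
  then have "P {y. \<not> balanced y} \<le>
      P (\<Union>a\<in>A. {y. n * pmf p a / 2 \<le> \<bar>\<Sum>i<n. indicator {a} (y i) - pmf p a\<bar>})"
    by (intro measure_pmf.finite_measure_mono) auto
  also have "\<dots> \<le> (\<Sum>a\<in>A. P {y. n * pmf p a / 2 \<le> \<bar>\<Sum>i<n. indicator {a} (y i) - pmf p a\<bar>})"
    using fin by (intro measure_pmf.finite_measure_subadditive_finite) auto
  also have "\<dots> \<le> (\<Sum>a\<in>A. 2 * exp (- (n / L) / 16))"
  proof (intro sum_mono)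
    fix a assume a: "a \<in> A"
    have pa: "0 < pmf p a" by (rule prob_pos[OF a])
    have np: "0 < n * pmf p a" using pa n_ge by simp
    have "P {y. n * pmf p a / 2 \<le> \<bar>\<Sum>i<n. indicator {a} (y i) - pmf p a\<bar>} \<le>
        2 * exp (- (n * pmf p a / 2)\<^sup>2 / (4 * (n * pmf p a)))"
    proof (intro iid_sum_tail fin expectation_centred_indicator_square pa)
      show "measure_pmf.expectation p (\<lambda>x. indicator {a} x - pmf p a) = 0"
        by (simp add: intp expectation_indicator measure_pmf_single)
      show "\<bar>indicator {a} x - pmf p a\<bar> \<le> 1" for x
        using pa pmf_le_1[of p a] by (auto simp: indicator_def)
    qed (use np n_ge in auto)
    also have "- (n * pmf p a / 2)\<^sup>2 / (4 * (n * pmf p a)) = - (n * pmf p a) / 16"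
      using np by (simp add: power2_eq_square)
    also have "exp (- (n * pmf p a) / 16) \<le> exp (- (n / L) / 16)"
    proof -
      have "n * (1 / L) \<le> n * pmf p a" by (intro mult_left_mono prob_atom a) auto
      then show ?thesis by simp
    qed
    finally show "P {y. n * pmf p a / 2 \<le> \<bar>\<Sum>i<n. indicator {a} (y i) - pmf p a\<bar>} \<le>
        2 * exp (- (n / L) / 16)" by simp
  qed
  finally show ?thesis by (simp add: card_atoms)
qed

text \<open>The mean is an average over an independent copy \<open>y'\<close>. A balanced copy
  differs from \<open>y\<close> by the two total deviations and a constant; an unbalanced one costs
  at most \<open>n\<close>, weighted by its small probability.\<close>

lemma min_bins_near_mean:
  assumes y: "\<forall>i<n. y i \<in> A" "balanced y"
  shows "\<bar>real (min_bins n y) - bins_mean n p\<bar> \<le> total_dev y +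
    (101 * real (Suc r) * sqrt V + 3 * real r + 2 * real r * (n * exp (- (n / L) / 16)))"
proof -
  have A1: "a \<le> 1" if "a \<in> A" for a using atoms that by force
  have "real (min_bins n y) - bins_mean n p = E (\<lambda>y'. real (min_bins n y) - real (min_bins n y'))"
    by (subst Bochner_Integration.integral_diff) (simp_all add: int bins_mean_def)
  also have "\<bar>\<dots>\<bar> \<le> E (\<lambda>y'. \<bar>real (min_bins n y) - real (min_bins n y')\<bar>)"
    by (rule integral_abs_bound)
  also have "\<dots> \<le> E (\<lambda>y'. (total_dev y + 3 * real r) + (total_dev y' + real n * indicator {y. \<not> balanced y} y'))"
  proof (intro integral_mono_AE int AE_pmfI)
    fix y' assume "y' \<in> set_pmf (iid_items n p)"
    then have y': "\<forall>i<n. y' i \<in> A" by (simp add: set_iid_items)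
    show "\<bar>real (min_bins n y) - real (min_bins n y')\<bar> \<le>
      (total_dev y + 3 * real r) + (total_dev y' + real n * indicator {y. \<not> balanced y} y')"
    proof (cases "balanced y'")
      case True
      then show ?thesis using min_bins_abs_diff_le[OF y y'] by simp
    next
      case False
      have "min_bins n y \<le> n" "min_bins n y' \<le> n"
        using y y' A1 by (auto intro!: min_bins_le_items)
      then show ?thesis using False total_dev_nonneg[of y] total_dev_nonneg[of y'] by simp
    qed
  qed
  also have "\<dots> = (total_dev y + 3 * real r) + (E total_dev + n * P {y. \<not> balanced y})"
    by (simp add: int)
  also have "n * P {y. \<not> balanced y} \<le> n * (2 * real r * exp (- (n / L) / 16))"
    by (intro mult_left_mono prob_not_balanced) auto
  finally show ?thesis using expectation_total_dev by (simp add: algebra_simps)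
qed

text \<open>\<open>B\<close> collects the errors of \<open>min_bins_near_mean\<close> in units of
  \<open>sqrt V\<close>. If \<open>V\<close> or \<open>t\<close> is small, the second summand of the
  constant makes the bound trivial. Otherwise the errors take at most half of \<open>t\<close>, and
  the sample must be unbalanced or have total deviation at least \<open>t / 2\<close>.\<close>

lemma concentration:
  fixes R :: nat and C t :: real
  assumes r: "r \<le> R" and C: "n * exp (- (n / L) / 16) \<le> C" and t: "0 < t" "t < V"
  defines "B \<equiv> 101 * real (Suc R) + 3 * real R + 2 * real R * C"
  defines "c \<equiv> 1 / (3200 * (real (Suc R))\<^sup>2)"
  shows "P {y. t + r \<le> \<bar>real (min_bins n y) - bins_mean n p\<bar>} \<le>
    (4 * real (Suc R) + exp (c * (4 * B\<^sup>2 + 1))) * exp (- c * t\<^sup>2 / V)"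
proof (cases "V < 1 \<or> t < 2 * B * sqrt V")
  case True
  have c: "0 < c" by (simp add: c_def)
  \<comment> \<open>With this estimate the claimed bound is at least 1, whatever the event.\<close>
  have "t\<^sup>2 / V \<le> 4 * B\<^sup>2 + 1"
  proof (cases "V < 1")
    case True
    have "t\<^sup>2 \<le> V * V" unfolding power2_eq_square using t by (intro mult_mono) auto
    then have "t\<^sup>2 / V \<le> V" using V_pos by (simp add: field_simps)
    then show ?thesis using True by (smt (verit) zero_le_power2)
  next
    case False
    then have "t\<^sup>2 \<le> (2 * B * sqrt V)\<^sup>2" using True t by (intro power_mono) auto
    also have "\<dots> = 4 * B\<^sup>2 * V" using V_pos by (simp add: power_mult_distrib)
    finally have "t\<^sup>2 / V \<le> 4 * B\<^sup>2" using V_pos by (simp add: pos_divide_le_eq)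
    then show ?thesis by simp
  qed
  then have "c * (t\<^sup>2 / V) \<le> c * (4 * B\<^sup>2 + 1)" using c by (intro mult_left_mono) auto
  then have "1 \<le> exp (c * (4 * B\<^sup>2 + 1) + - c * t\<^sup>2 / V)" by simp
  also have "\<dots> = exp (c * (4 * B\<^sup>2 + 1)) * exp (- c * t\<^sup>2 / V)" by (rule exp_add)
  also have "\<dots> \<le> (4 * real (Suc R) + exp (c * (4 * B\<^sup>2 + 1))) * exp (- c * t\<^sup>2 / V)"
    by (intro mult_right_mono) auto
  finally show ?thesis using measure_pmf.prob_le_1 by (rule order_trans[rotated])
next
  case False
  then have V1: "1 \<le> V" and tB: "B * sqrt V \<le> t / 2" by auto
  have s1: "1 \<le> sqrt V" using V1 by simp
  have C0: "0 \<le> C" using C by (smt (verit) exp_ge_zero mult_nonneg_nonneg of_nat_0_le_iff)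
  have "101 * real (Suc r) * sqrt V + 3 * real r + 2 * real r * (n * exp (- (n / L) / 16)) \<le>
      101 * real (Suc R) * sqrt V + 3 * real R * sqrt V + 2 * real R * C * sqrt V"
  proof (intro add_mono)
    show "101 * real (Suc r) * sqrt V \<le> 101 * real (Suc R) * sqrt V"
      using r V_pos by (intro mult_right_mono) auto
    have "3 * real r * 1 \<le> 3 * real R * sqrt V" using r s1 by (intro mult_mono) auto
    then show "3 * real r \<le> 3 * real R * sqrt V" by simp
    have "2 * real r * (n * exp (- (n / L) / 16)) * 1 \<le> 2 * real R * C * sqrt V"
      using r s1 C C0 by (intro mult_mono) auto
    then show "2 * real r * (n * exp (- (n / L) / 16)) \<le> 2 * real R * C * sqrt V" by simp
  qed
  also have "\<dots> = B * sqrt V" by (simp add: B_def algebra_simps)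
  finally have slack: "101 * real (Suc r) * sqrt V + 3 * real r + 2 * real r * (n * exp (- (n / L) / 16)) \<le> t / 2"
    using tB by linarith
  have "P {y. t + r \<le> \<bar>real (min_bins n y) - bins_mean n p\<bar>} \<le>
      P ({y. \<not> balanced y} \<union> {y. t / 2 \<le> total_dev y})"
  proof (intro measure_pmf.finite_measure_mono_AE AE_pmfI impI)
    fix y assume y: "y \<in> set_pmf (iid_items n p)"
      "y \<in> {y. t + r \<le> \<bar>real (min_bins n y) - bins_mean n p\<bar>}"
    then have "\<forall>i<n. y i \<in> A" by (simp add: set_iid_items)
    then show "y \<in> {y. \<not> balanced y} \<union> {y. t / 2 \<le> total_dev y}"
      using min_bins_near_mean[of y] y(2) slack by force
  qed auto
  also have "\<dots> \<le> P {y. \<not> balanced y} + P {y. t / 2 \<le> total_dev y}"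
    by (rule measure_Un_le) auto
  also have "\<dots> \<le> 2 * real (Suc R) * exp (- c * t\<^sup>2 / V) + 2 * real (Suc R) * exp (- c * t\<^sup>2 / V)"
  proof (intro add_mono)
    have "t\<^sup>2 / V \<le> V"
    proof -
      have "t\<^sup>2 \<le> V * V" unfolding power2_eq_square using t by (intro mult_mono) auto
      then show ?thesis using V_pos by (simp add: field_simps)
    qed
    with V_le have tV: "t\<^sup>2 / V \<le> 2 * (n / L)" by linarith
    \<comment> \<open>From \<open>c \<le> 1 / 32\<close> and \<open>tV\<close>, the exponent
      \<open>c * t\<^sup>2 / V\<close> is at most \<open>n / L / 16\<close>, so the tail for
      unbalanced samples is absorbed.\<close>
    have "32 * 1 \<le> 3200 * (real (Suc R))\<^sup>2" by (intro mult_mono) auto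
    then have "c \<le> 1 / 32"
      unfolding c_def by (intro divide_left_mono) auto
    then have "c * (t\<^sup>2 / V) \<le> 1 / 32 * (2 * (n / L))"
      using tV V_pos by (intro mult_mono) auto
    then have "exp (- (n / L) / 16) \<le> exp (- c * t\<^sup>2 / V)" by simp
    then have "2 * real r * exp (- (n / L) / 16) \<le> 2 * real (Suc R) * exp (- c * t\<^sup>2 / V)"
      using r by (intro mult_mono) auto
    then show "P {y. \<not> balanced y} \<le> 2 * real (Suc R) * exp (- c * t\<^sup>2 / V)"
      using prob_not_balanced by linarith
    have "P {y. t / 2 \<le> total_dev y} \<le> 2 * real (Suc r) * exp (- (t / 2)\<^sup>2 / (800 * (real (Suc r))\<^sup>2 * V))"
      using t by (intro prob_total_dev) auto
    also have "\<dots> \<le> 2 * real (Suc R) * exp (- c * t\<^sup>2 / V)"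
    proof (intro mult_mono)
      have "(t / 2)\<^sup>2 / (800 * (real (Suc R))\<^sup>2 * V) \<le> (t / 2)\<^sup>2 / (800 * (real (Suc r))\<^sup>2 * V)"
      proof (rule frac_le)
        show "0 < 800 * (real (Suc r))\<^sup>2 * V"
          by (rule mult_pos_pos[OF _ V_pos]) simp
        show "800 * (real (Suc r))\<^sup>2 * V \<le> 800 * (real (Suc R))\<^sup>2 * V"
          using r V_pos by (intro mult_right_mono mult_left_mono power_mono) auto
      qed auto
      \<comment> \<open>The 3200 in \<open>c\<close> is 800 times the 4 from halving
        \<open>t\<close>.\<close>
      moreover have "(t / 2)\<^sup>2 / (800 * (real (Suc R))\<^sup>2 * V) = c * t\<^sup>2 / V"
        by (simp add: c_def power_divide del: of_nat_Suc)
      ultimately show "exp (- (t / 2)\<^sup>2 / (800 * (real (Suc r))\<^sup>2 * V)) \<le> exp (- c * t\<^sup>2 / V)" by simp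
    qed (use r in auto)
    finally show "P {y. t / 2 \<le> total_dev y} \<le> 2 * real (Suc R) * exp (- c * t\<^sup>2 / V)" .
  qed
  also have "\<dots> = 4 * real (Suc R) * exp (- c * t\<^sup>2 / V)" by simp
  also have "\<dots> \<le> (4 * real (Suc R) + exp (c * (4 * B\<^sup>2 + 1))) * exp (- c * t\<^sup>2 / V)"
    by (intro mult_right_mono) auto
  finally show ?thesis .
qed

end

text \<open>Bounds the share of unbalanced copies in the mean uniformly in \<open>n\<close>: a
  sequence tending to 0 is bounded, small indices included.\<close>

lemma exists_bound_n_exp_neg_n_div_ln:
  "\<exists>C. \<forall>n::nat. n * exp (- (n / ln (real n)) / 16) \<le> C"
proof -
  have "(\<lambda>n::nat. n * exp (- (n / ln (real n)) / 16)) \<longlonglongrightarrow> 0" by real_asymp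
  then have "Bseq (\<lambda>n::nat. n * exp (- (n / ln (real n)) / 16))"
    by (rule convergent_imp_Bseq[OF convergentI])
  then obtain C where "\<And>n::nat. norm (n * exp (- (n / ln (real n)) / 16)) \<le> C"
    by (rule BseqE) (use that in blast)
  then show ?thesis by (intro exI[of _ C]) (force simp: abs_le_iff)
qed

lemma concentration_uniform:
  "\<forall>R::nat. \<exists>c>0. \<exists>c\<^sub>1>0. \<forall>n\<ge>2. \<forall>r\<le>R. \<forall>p :: real pmf. admissible_law n r p \<longrightarrow>
     (\<forall>t::real. 0 < t \<and> t < real n * (item_mean p ^ 3 + item_var p) \<longrightarrow>
        measure_pmf.prob (iid_items n p)
          {y. \<bar>real (min_bins n y) - bins_mean n p\<bar> \<ge> t + real r}
        \<le> c\<^sub>1 * exp (- c * t\<^sup>2 / (real n * (item_mean p ^ 3 + item_var p))))"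
proof
  fix R :: nat
  obtain C where C: "\<And>n::nat. n * exp (- (n / ln (real n)) / 16) \<le> C"
    using exists_bound_n_exp_neg_n_div_ln by auto
  define c where "c = 1 / (3200 * (real (Suc R))\<^sup>2)"
  define c\<^sub>1 where "c\<^sub>1 = 4 * real (Suc R) + exp (c * (4 * (101 * real (Suc R) + 3 * real R + 2 * real R * C)\<^sup>2 + 1))"
  show "\<exists>c>0. \<exists>c\<^sub>1>0. \<forall>n\<ge>2. \<forall>r\<le>R. \<forall>p :: real pmf. admissible_law n r p \<longrightarrow>
     (\<forall>t::real. 0 < t \<and> t < real n * (item_mean p ^ 3 + item_var p) \<longrightarrow>
        measure_pmf.prob (iid_items n p)
          {y. \<bar>real (min_bins n y) - bins_mean n p\<bar> \<ge> t + real r}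
        \<le> c\<^sub>1 * exp (- c * t\<^sup>2 / (real n * (item_mean p ^ 3 + item_var p))))"
  proof (rule exI[of _ c], intro exI[of _ c\<^sub>1] conjI allI impI)
    show "0 < c" by (simp add: c_def)
    show "0 < c\<^sub>1" unfolding c\<^sub>1_def by (intro add_nonneg_pos) auto
    fix n r :: nat and p :: "real pmf" and t :: real
    assume *: "2 \<le> n" "r \<le> R" "admissible_law n r p"
      and t: "0 < t \<and> t < real n * (item_mean p ^ 3 + item_var p)"
    interpret admissible n r p by unfold_locales (fact *)+
    show "P {y. \<bar>real (min_bins n y) - bins_mean n p\<bar> \<ge> t + real r} \<le> c\<^sub>1 * exp (- c * t\<^sup>2 / V)"
      using concentration[OF *(2) C, of t] t by (simp only: c_def c\<^sub>1_def)
  qed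
qed


subsection \<open>Lower bound for the variance\<close>

text \<open>Both sizes divide the capacity exactly, so a bin filled with a single size has no
  waste.\<close>

definition half_whole_law :: "nat \<Rightarrow> real pmf" where
  "half_whole_law k = pmf_of_set {1 / (2 * real k), 1 / real k}"

lemma set_half_whole_law: "set_pmf (half_whole_law k) = {1 / (2 * real k), 1 / real k}"
  by (simp add: half_whole_law_def)

lemma expectation_half_whole_law:
  fixes g :: "real \<Rightarrow> real"
  assumes "0 < k"
  shows "measure_pmf.expectation (half_whole_law k) g = (g (1 / (2 * real k)) + g (1 / real k)) / 2"
  unfolding half_whole_law_def using assms
  by (subst integral_pmf_of_set) (auto simp: divide_simps)

lemma item_mean_half_whole_law: "0 < k \<Longrightarrow> item_mean (half_whole_law k) = 3 / (4 * real k)"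
  by (simp add: item_mean_def expectation_half_whole_law field_simps)

lemma item_var_half_whole_law: "0 < k \<Longrightarrow> item_var (half_whole_law k) = 1 / (16 * (real k)\<^sup>2)"
  by (simp add: item_var_def expectation_half_whole_law field_simps power2_eq_square)

text \<open>All bins are new and hold one size each. As \<open>1 / a\<close> is an integer, the only
  loss is one partially filled bin for each of the two sizes.\<close>

lemma min_bins_half_whole_le:
  assumes k: "0 < k" and y: "\<forall>i<n. y i \<in> {1 / (2 * real k), 1 / real k}"
  shows "real (min_bins n y) \<le> (\<Sum>i<n. y i) + 2"
proof -
  let ?A = "{1 / (2 * real k), 1 / real k}"
  have k': "1 / (2 * real k) \<noteq> 1 / real k" using k by (simp add: divide_simps)
  have fl: "\<lfloor>2 * real k\<rfloor> = 2 * int k"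
    using floor_of_int[of "2 * int k", where 'a = real] by simp
  have "real (min_bins n y) \<le> card ({} :: nat set) +
    (\<Sum>a\<in>?A. real (item_count n y a - (\<Sum>j\<in>({} :: nat set). 0)) / real_of_int \<lfloor>1 / a\<rfloor> + 1)"
    using y k by (intro min_bins_le_kept_plus_new[where b = "\<lambda>_ _. 0"]) (auto simp: divide_simps)
  also have "\<dots> = (\<Sum>a\<in>?A. item_count n y a * a) + 2"
    using k' by (simp add: fl)
  also have "(\<Sum>a\<in>?A. item_count n y a * a) = (\<Sum>i<n. y i)"
    using sum_items_by_size[of ?A n y "\<lambda>a. a"] y by simp
  finally show ?thesis .
qed

text \<open>The excess \<open>e\<close> of the bin count over the total size lies between 0 and 2.
  So the centred total size is the centred bin count \<open>u\<close> minus some \<open>z\<close>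
  with \<open>\<bar>z\<bar> \<le> 2\<close>, and its square is at most
  \<open>2 * u\<^sup>2 + 8\<close>; taking expectations compares the variances.\<close>

lemma bins_var_half_whole_ge:
  assumes k: "2 \<le> k"
  shows "n / (32 * (real k)\<^sup>2) - 4 \<le> bins_var n (half_whole_law k)"
proof -
  let ?p = "half_whole_law k"
  let ?E = "measure_pmf.expectation (iid_items n ?p)"
  define \<mu> where "\<mu> = item_mean ?p"
  define e where "e = (\<lambda>y. real (min_bins n y) - (\<Sum>i<n. y i))"
  have fin: "finite (set_pmf ?p)" by (simp add: set_half_whole_law)
  have int: "integrable (iid_items n ?p) h" for h :: "_ \<Rightarrow> real"
    by (intro integrable_measure_pmf_finite finite_set_iid_items fin)
  have intp: "integrable ?p h" for h :: "_ \<Rightarrow> real"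
    by (intro integrable_measure_pmf_finite fin)
  have e: "0 \<le> e y" "e y \<le> 2" if "y \<in> set_pmf (iid_items n ?p)" for y
  proof -
    have y: "\<forall>i<n. y i \<in> {1 / (2 * real k), 1 / real k}"
      using that by (simp add: set_iid_items set_half_whole_law)
    moreover have "\<forall>a\<in>{1 / (2 * real k), 1 / real k}. a \<le> 1" using k by (auto simp: divide_simps)
    ultimately have "\<forall>i<n. y i \<le> 1" by blast
    then show "0 \<le> e y" unfolding e_def using sum_items_le_min_bins[of n y] by simp
    show "e y \<le> 2" unfolding e_def using min_bins_half_whole_le[OF _ y] k by simp
  qed
  have Ee: "0 \<le> ?E e" "?E e \<le> 2"
  proof -
    show "0 \<le> ?E e" by (intro integral_nonneg_AE AE_pmfI e)
    have "?E e \<le> ?E (\<lambda>_. 2)" by (intro integral_mono_AE int AE_pmfI e)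
    then show "?E e \<le> 2" by simp
  qed
  have ES: "?E (\<lambda>y. \<Sum>i<n. y i) = n * \<mu>"
    using expectation_iid_sum[OF fin, of n "\<lambda>x. x"] by (simp add: \<mu>_def item_mean_def)
  have Ef: "bins_mean n ?p = n * \<mu> + ?E e"
    unfolding bins_mean_def ES[symmetric]
    by (subst Bochner_Integration.integral_add[symmetric]) (simp_all add: int e_def)
  have "n * (1 / (16 * (real k)\<^sup>2)) = n * measure_pmf.expectation ?p (\<lambda>x. (x - \<mu>)\<^sup>2)"
    using item_var_half_whole_law[of k] k by (simp add: item_var_def \<mu>_def item_mean_def)
  also have "\<dots> = ?E (\<lambda>y. (\<Sum>i<n. y i - \<mu>)\<^sup>2)"
    by (intro expectation_iid_centered_sum_square[OF fin, symmetric])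
      (simp add: intp \<mu>_def item_mean_def)
  also have "\<dots> \<le> ?E (\<lambda>y. 2 * (real (min_bins n y) - bins_mean n ?p)\<^sup>2 + 8)"
  proof (intro integral_mono_AE int AE_pmfI)
    fix y assume y: "y \<in> set_pmf (iid_items n ?p)"
    define u where "u = real (min_bins n y) - bins_mean n ?p"
    define z where "z = e y - ?E e"
    have "(\<Sum>i<n. y i - \<mu>) = u - z"
      by (simp add: u_def z_def Ef e_def sum_subtractf)
    moreover have "z\<^sup>2 \<le> 2\<^sup>2"
      using e[OF y] Ee by (intro power2_le_iff_abs_le[THEN iffD2]) (auto simp: z_def)
    moreover have "(u - z)\<^sup>2 \<le> 2 * u\<^sup>2 + 2 * z\<^sup>2"
      using zero_le_power2[of "u + z"] by (simp add: power2_eq_square algebra_simps)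
    ultimately show "(\<Sum>i<n. y i - \<mu>)\<^sup>2 \<le> 2 * (real (min_bins n y) - bins_mean n ?p)\<^sup>2 + 8"
      by (simp add: u_def)
  qed
  also have "\<dots> = 2 * bins_var n ?p + 8"
    by (simp add: int bins_var_def bins_mean_def)
  finally show ?thesis by (simp add: field_simps)
qed

text \<open>The cubed mean and the variance together are at most
  \<open>31 / (64 * k\<^sup>2)\<close>, hence at most \<open>1 / (2 * k\<^sup>2)\<close>. The lower
  limit on \<open>n\<close> makes the loss of 4 at most half of
  \<open>n / (32 * k\<^sup>2)\<close>.\<close>

lemma bins_var_half_whole_order:
  assumes k: "2 \<le> k" and n: "256 * (real k)\<^sup>2 \<le> real n"
  shows "1 / 32 * (n * (item_mean (half_whole_law k) ^ 3 + item_var (half_whole_law k)))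
    \<le> bins_var n (half_whole_law k)"
proof -
  have k2: "0 < (real k)\<^sup>2" "(real k)\<^sup>2 \<le> real k ^ 3" using k by (auto intro: power_increasing)
  have "(3 / (4 * real k)) ^ 3 = 27 / (64 * real k ^ 3)"
    by (simp add: power_divide power_mult_distrib)
  also have "\<dots> \<le> 27 / (64 * (real k)\<^sup>2)" using k2 by (intro divide_left_mono) auto
  finally have "(3 / (4 * real k)) ^ 3 + 1 / (16 * (real k)\<^sup>2) \<le> 27 / (64 * (real k)\<^sup>2) + 1 / (16 * (real k)\<^sup>2)"
    by simp
  also have "\<dots> \<le> 1 / (2 * (real k)\<^sup>2)" using k2 by (simp add: field_simps)
  finally have "1 / 32 * (n * ((3 / (4 * real k)) ^ 3 + 1 / (16 * (real k)\<^sup>2))) \<le>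
      1 / 32 * (n * (1 / (2 * (real k)\<^sup>2)))"
    by (intro mult_left_mono) auto
  also have "1 / 32 * (n * (1 / (2 * (real k)\<^sup>2))) \<le> n / (32 * (real k)\<^sup>2) - 4"
    using n k2 by (simp add: field_simps)
  also have "\<dots> \<le> bins_var n (half_whole_law k)" by (rule bins_var_half_whole_ge[OF k])
  finally show ?thesis
    using k by (simp add: item_mean_half_whole_law[of k] item_var_half_whole_law[of k])
qed

text \<open>\<open>k\<close> may vary with \<open>n\<close>, which covers both a fixed law and laws
  whose mean shrinks like \<open>1 / ln n\<close>.\<close>

lemma bins_var_half_whole_bigomega:
  assumes "\<And>n. 2 \<le> k n" "\<forall>\<^sub>F n in sequentially. 256 * (real (k n))\<^sup>2 \<le> real n"
  shows "(\<lambda>n. bins_var n (half_whole_law (k n))) \<in>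
    \<Omega>(\<lambda>n. real n * (item_mean (half_whole_law (k n)) ^ 3 + item_var (half_whole_law (k n))))"
proof (rule landau_omega.bigI)
  show "\<forall>\<^sub>F n in sequentially. 1 / 32 * norm (real n * (item_mean (half_whole_law (k n)) ^ 3 +
      item_var (half_whole_law (k n)))) \<le> norm (bins_var n (half_whole_law (k n)))"
    using assms(2)
  proof eventually_elim
    case (elim n)
    have "0 \<le> real n * (item_mean (half_whole_law (k n)) ^ 3 + item_var (half_whole_law (k n)))"
      using assms(1)[of n] by (simp add: item_mean_half_whole_law item_var_half_whole_law)
    then show ?case
      using bins_var_half_whole_order[OF assms(1) elim] by simp
  qed
qed simp

text \<open>The mean \<open>3 / (4 * k)\<close> is at most \<open>1 / (4 * ln n)\<close> exactly
  when \<open>k\<close> is at least \<open>3 * ln n\<close>; the atoms of probability 1/2 require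
  \<open>ln n\<close> to be at least 2.\<close>

lemma admissible_half_whole_law:
  assumes "2 \<le> k" "3 * ln (real n) \<le> k" "2 \<le> ln (real n)"
  shows "admissible_law n 2 (half_whole_law k)"
proof -
  have ne: "1 / (2 * real k) \<noteq> 1 / real k" using assms by (simp add: divide_simps)
  have "1 / ln (real n) \<le> pmf (half_whole_law k) a" if "a \<in> set_pmf (half_whole_law k)" for a
    using that ne assms unfolding set_half_whole_law
    by (auto simp: half_whole_law_def card_insert_if field_simps)
  moreover have "3 / (4 * real k) \<le> 1 / (2\<^sup>2 * ln (real n))"
    using assms by (simp add: field_simps)
  moreover have "set_pmf (half_whole_law k) \<subseteq> {0<..<1}"
    using assms by (auto simp: set_half_whole_law divide_simps)
  ultimately show ?thesis
    using assms ne by (simp add: admissible_law_def set_half_whole_law item_mean_half_whole_law)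
qed

lemma variance_lower_bound_fixed:
  "\<exists>p :: real pmf. set_pmf p \<subseteq> {0<..<1} \<and>
     (\<lambda>n. bins_var n p) \<in> \<Omega>(\<lambda>n. real n * (item_mean p ^ 3 + item_var p))"
proof (intro exI[of _ "half_whole_law 2"] conjI)
  show "(\<lambda>n. bins_var n (half_whole_law 2)) \<in>
      \<Omega>(\<lambda>n. real n * (item_mean (half_whole_law 2) ^ 3 + item_var (half_whole_law 2)))"
    by (rule bins_var_half_whole_bigomega) (simp, real_asymp)
qed (simp add: set_half_whole_law)

lemma variance_lower_bound_admissible:
  "\<exists>r. \<exists>p :: nat \<Rightarrow> real pmf. (\<forall>\<^sub>F n in sequentially. admissible_law n r (p n)) \<and>
     (\<lambda>n. bins_var n (p n)) \<in> \<Omega>(\<lambda>n. real n * (item_mean (p n) ^ 3 + item_var (p n)))"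
proof -
  \<comment> \<open>The ceiling meets the constraint on the mean, and adding 2 gives
    \<open>2 \<le> k n\<close> for every \<open>n\<close>. Logarithmic growth leaves
    \<open>256 * (k n)\<^sup>2\<close> eventually below \<open>n\<close>.\<close>
  define k :: "nat \<Rightarrow> nat" where "k = (\<lambda>n. nat \<lceil>3 * ln (real n)\<rceil> + 2)"
  have k2: "2 \<le> k n" for n by (simp add: k_def)
  have kl: "3 * ln (real n) \<le> k n" for n
    unfolding k_def using real_nat_ceiling_ge[of "3 * ln (real n)"] by simp
  have ku: "real (k n) \<le> 3 * ln (real n) + 3" if "1 \<le> n" for n
  proof -
    have "0 \<le> \<lceil>3 * ln (real n)\<rceil>" using that by (simp add: ln_ge_zero less_le_trans[of "-1" 0])
    then have "real (k n) = of_int \<lceil>3 * ln (real n)\<rceil> + 2" by (simp add: k_def)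
    then show ?thesis using of_int_ceiling_le_add_one[of "3 * ln (real n)"] by linarith
  qed
  have "\<forall>\<^sub>F n in sequentially. 256 * (3 * ln (real n) + 3)\<^sup>2 \<le> real n"
    by real_asymp
  with eventually_ge_at_top[of 1] have ev: "\<forall>\<^sub>F n in sequentially. 256 * (real (k n))\<^sup>2 \<le> real n"
  proof eventually_elim
    case (elim n)
    have "(real (k n))\<^sup>2 \<le> (3 * ln (real n) + 3)\<^sup>2"
      using ku[OF elim(1)] by (intro power_mono) auto
    then show ?case using elim by linarith
  qed
  have "\<forall>\<^sub>F n in sequentially. 2 \<le> ln (real n)" by real_asymp
  then have "\<forall>\<^sub>F n in sequentially. admissible_law n 2 (half_whole_law (k n))"
    by eventually_elim (intro admissible_half_whole_law k2 kl)
  then show ?thesis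
    using bins_var_half_whole_bigomega[OF k2 ev]
    by (intro exI[of _ 2] exI[of _ "\<lambda>n. half_whole_law (k n)"]) auto
qed

theorem theorem8:
  shows "(\<forall>R::nat. \<exists>c>0. \<exists>c\<^sub>1>0. \<forall>n\<ge>2. \<forall>r\<le>R. \<forall>p :: real pmf. admissible_law n r p \<longrightarrow>
            (\<forall>t::real. 0 < t \<and> t < real n * (item_mean p ^ 3 + item_var p) \<longrightarrow>
               measure_pmf.prob (iid_items n p)
                 {y. \<bar>real (min_bins n y) - bins_mean n p\<bar> \<ge> t + real r}
               \<le> c\<^sub>1 * exp (- c * t\<^sup>2 / (real n * (item_mean p ^ 3 + item_var p)))))
       \<and> (\<exists>p :: real pmf. set_pmf p \<subseteq> {0<..<1} \<and>
            (\<lambda>n. bins_var n p) \<in> \<Omega>(\<lambda>n. real n * (item_mean p ^ 3 + item_var p)))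
       \<and> (\<exists>r. \<exists>p :: nat \<Rightarrow> real pmf. (\<forall>\<^sub>F n in sequentially. admissible_law n r (p n)) \<and>
            (\<lambda>n. bins_var n (p n)) \<in> \<Omega>(\<lambda>n. real n * (item_mean (p n) ^ 3 + item_var (p n))))"
  using concentration_uniform variance_lower_bound_fixed variance_lower_bound_admissible
  by (intro conjI)

end
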